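(* Let $R=\bigoplus_{\alpha\in\Gamma}R_{\alpha}$ be a graded domain. Then the following are equivalent: (1) $R$ is a gGD domain; (2) $R\subseteq R[u]$ satisfies gGD for each homogeneous element $u\in R_H$; (3) $R\subseteq V$ satisfies gGD for each gr-valuation overring $V$ of $R$; (4) $R\subseteq T$ satisfies gGD for each graded domain $T$ containing $R$ as a graded subring.
   Context: All rings are commutative with identity. $\Gamma$ is a nonzero torsionless commutative cancellative monoid, written additively (torsionless is equivalent to the existence of a total order compatible with the monoid operation), with quotient group $\langle\Gamma\rangle$. A graded domain $R=\bigoplus_{\alpha\in\Gamma}R_\alpha$ is an integral domain graded by such a monoid; $H=\bigcup_{\alpha\in\Gamma}(R_\alpha\setminus\{0\})$ is its set of nonzero homogeneous elements. The homogeneous quotient field $R_H$ is graded by $\langle\Gamma\rangle$ via $\deg(a/b)=\deg(a)-\deg(b)$. A homogeneous overring of $R$ is a ring $T$ with $R\subseteq T\subseteq R_H$ and $T=\bigoplus_{\alpha\in\langle\Gamma\rangle}(T\cap(R_H)_\alpha)$; it is a $\langle\Gamma\rangle$-graded domain. An ideal is homogeneous if it is generated by homogeneous elements. $R$ is a graded subring of a graded domain $T=\bigoplus_{\alpha\in\Lambda}T_\alpha$ ($\Lambda$ a torsionless commutative cancellative monoid), i.e. $R\subseteq T$ is an extension of graded domains, if $R$ is a subring of $T$, $\Gamma$ is a subsemigroup of $\Lambda$ and $R_\alpha\subseteq T_\alpha$ for all $\alpha\in\Gamma$. Such an extension satisfies gGD (graded going-down) if, whenever $P_0\subseteq P$ are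 homogeneous prime ideals of $R$ and $Q$ is a homogeneous prime ideal of $T$ with $Q\cap R=P$, there is a homogeneous prime ideal $Q_0$ of $T$ with $Q_0\subseteq Q$ and $Q_0\cap R=P_0$. $R$ is a gGD domain if $R\subseteq T$ satisfies gGD for every homogeneous overring $T$ of $R$. For homogeneous $u\in R_H$, $R[u]$ is a homogeneous overring of $R$. A graded domain $V$ is a gr-valuation domain if for all nonzero homogeneous $a,b\in V$ either $aV\subseteq bV$ or $bV\subseteq aV$. A gr-valuation overring of $R$ is a homogeneous overring of $R$ that is a gr-valuation domain. *)

theory Defs
  imports "HOL-Computational_Algebra.Polynomial" "HOL.Hull"
begin

text \<open>
  Every integral domain embeds in a field and every commutative cancellative monoid embeds in an
  abelian group, so rings are modelled as subrings of a domain given as a type (of a field, where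
  fractions are needed), and grading monoids as submonoids of an abelian group given as a type.
  Inclusions between rings and between grading monoids are then inclusions of sets.
\<close>

definition subring_set :: "'a::comm_ring_1 set \<Rightarrow> bool" where
  "subring_set S \<longleftrightarrow> 1 \<in> S \<and> (\<forall>x\<in>S. \<forall>y\<in>S. x - y \<in> S \<and> x * y \<in> S)"

definition ideal_of :: "'a::comm_ring_1 set \<Rightarrow> 'a set \<Rightarrow> bool" where
  "ideal_of S I \<longleftrightarrow>
     I \<subseteq> S \<and> 0 \<in> I \<and> (\<forall>x\<in>I. \<forall>y\<in>I. x + y \<in> I) \<and> (\<forall>s\<in>S. \<forall>x\<in>I. s * x \<in> I)"

definition prime_ideal_of :: "'a::comm_ring_1 set \<Rightarrow> 'a set \<Rightarrow> bool" where
  "prime_ideal_of S P \<longleftrightarrow>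
     ideal_of S P \<and> P \<noteq> S \<and> (\<forall>x\<in>S. \<forall>y\<in>S. x * y \<in> P \<longrightarrow> x \<in> P \<or> y \<in> P)"

definition torsionless_monoid :: "'g::ab_group_add set \<Rightarrow> bool" where
  "torsionless_monoid M \<longleftrightarrow>
     0 \<in> M \<and> (\<forall>a\<in>M. \<forall>b\<in>M. a + b \<in> M) \<and>
     (\<forall>a\<in>M. \<forall>b\<in>M. \<forall>n>0. (\<Sum>i<(n::nat). a) = (\<Sum>i<n. b) \<longrightarrow> a = b)"

definition quotient_group :: "'g::ab_group_add set \<Rightarrow> 'g set" where
  "quotient_group M = {a - b | a b. a \<in> M \<and> b \<in> M}"

definition internal_direct_sum ::
  "'g set \<Rightarrow> ('g \<Rightarrow> 'a::ab_group_add set) \<Rightarrow> 'a set \<Rightarrow> bool" where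
  "internal_direct_sum M C S \<longleftrightarrow>
     (\<forall>g\<in>M. 0 \<in> C g \<and> (\<forall>x\<in>C g. \<forall>y\<in>C g. x - y \<in> C g)) \<and>
     S = {\<Sum>g\<in>F. x g | F x. finite F \<and> F \<subseteq> M \<and> (\<forall>g\<in>F. x g \<in> C g)} \<and>
     (\<forall>F x. finite F \<and> F \<subseteq> M \<and> (\<forall>g\<in>F. x g \<in> C g) \<and> (\<Sum>g\<in>F. x g) = 0
        \<longrightarrow> (\<forall>g\<in>F. x g = 0))"

text \<open>Only the values of \<open>component\<close> at elements of \<open>degrees\<close> are meaningful.\<close>

record ('g, 'a) graded_ring =
  degrees :: "'g set"
  component :: "'g \<Rightarrow> 'a set"
  elements :: "'a set"

definition graded_domain :: "('g::ab_group_add, 'a::idom) graded_ring \<Rightarrow> bool" where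
  "graded_domain R \<longleftrightarrow>
     torsionless_monoid (degrees R) \<and> degrees R \<noteq> {0} \<and>
     subring_set (elements R) \<and>
     internal_direct_sum (degrees R) (component R) (elements R) \<and>
     (\<forall>a\<in>degrees R. \<forall>b\<in>degrees R. \<forall>x\<in>component R a. \<forall>y\<in>component R b.
        x * y \<in> component R (a + b))"

definition nz_homogeneous :: "('g, 'a::idom) graded_ring \<Rightarrow> 'a set" where
  "nz_homogeneous R = (\<Union>a\<in>degrees R. component R a - {0})"

definition homogeneous_ideal :: "('g, 'a::idom) graded_ring \<Rightarrow> 'a set \<Rightarrow> bool" where
  "homogeneous_ideal R I \<longleftrightarrow>
     ideal_of (elements R) I \<and>
     (\<exists>G \<subseteq> nz_homogeneous R. I = ideal_of (elements R) hull G)"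

definition homogeneous_prime :: "('g, 'a::idom) graded_ring \<Rightarrow> 'a set \<Rightarrow> bool" where
  "homogeneous_prime R P \<longleftrightarrow> homogeneous_ideal R P \<and> prime_ideal_of (elements R) P"

definition graded_subring ::
  "('g::ab_group_add, 'a::idom) graded_ring \<Rightarrow> ('g, 'a) graded_ring \<Rightarrow> bool" where
  "graded_subring R T \<longleftrightarrow>
     graded_domain R \<and> graded_domain T \<and>
     elements R \<subseteq> elements T \<and> degrees R \<subseteq> degrees T \<and>
     (\<forall>a\<in>degrees R. component R a \<subseteq> component T a)"

definition gGD :: "('g, 'a::idom) graded_ring \<Rightarrow> ('g, 'a) graded_ring \<Rightarrow> bool" where
  "gGD R T \<longleftrightarrow>
     (\<forall>P\<^sub>0 P Q. homogeneous_prime R P\<^sub>0 \<and> homogeneous_prime R P \<and> P\<^sub>0 \<subseteq> P \<and>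
        homogeneous_prime T Q \<and> Q \<inter> elements R = P
        \<longrightarrow> (\<exists>Q\<^sub>0. homogeneous_prime T Q\<^sub>0 \<and> Q\<^sub>0 \<subseteq> Q \<and> Q\<^sub>0 \<inter> elements R = P\<^sub>0))"

definition hqf :: "('g, 'a::field) graded_ring \<Rightarrow> 'a set" where
  "hqf R = {a / b | a b. a \<in> elements R \<and> b \<in> nz_homogeneous R}"

text \<open>
  The zero has to be added explicitly: if \<open>g\<close> is not of the form \<open>a - b\<close> with
  \<open>component R b \<noteq> {0}\<close>, then there is no fraction of degree \<open>g\<close> at all.
\<close>

definition hqf_component ::
  "('g::ab_group_add, 'a::field) graded_ring \<Rightarrow> 'g \<Rightarrow> 'a set" where
  "hqf_component R g =
     insert 0 {x / y | x y a b. a \<in> degrees R \<and> b \<in> degrees R \<and> g = a - b \<and>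
       x \<in> component R a \<and> y \<in> component R b \<and> y \<noteq> 0}"

definition hqf_homogeneous :: "('g::ab_group_add, 'a::field) graded_ring \<Rightarrow> 'a set" where
  "hqf_homogeneous R = (\<Union>g\<in>quotient_group (degrees R). hqf_component R g)"

definition overring_grading ::
  "('g::ab_group_add, 'a::field) graded_ring \<Rightarrow> 'a set \<Rightarrow> ('g, 'a) graded_ring" where
  "overring_grading R T =
     \<lparr>degrees = quotient_group (degrees R), component = (\<lambda>g. T \<inter> hqf_component R g),
      elements = T\<rparr>"

definition homogeneous_overring ::
  "('g::ab_group_add, 'a::field) graded_ring \<Rightarrow> 'a set \<Rightarrow> bool" where
  "homogeneous_overring R T \<longleftrightarrow>
     subring_set T \<and> elements R \<subseteq> T \<and> T \<subseteq> hqf R \<and>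
     internal_direct_sum (quotient_group (degrees R)) (\<lambda>g. T \<inter> hqf_component R g) T"

definition gGD_domain :: "('g::ab_group_add, 'a::field) graded_ring \<Rightarrow> bool" where
  "gGD_domain R \<longleftrightarrow> (\<forall>T. homogeneous_overring R T \<longrightarrow> gGD R (overring_grading R T))"

definition adjoin :: "'a::comm_ring_1 set \<Rightarrow> 'a \<Rightarrow> 'a set" where
  "adjoin S u = {poly p u | p. \<forall>i. coeff p i \<in> S}"

definition gr_valuation_domain :: "('g::ab_group_add, 'a::idom) graded_ring \<Rightarrow> bool" where
  "gr_valuation_domain V \<longleftrightarrow>
     graded_domain V \<and>
     (\<forall>a\<in>nz_homogeneous V. \<forall>b\<in>nz_homogeneous V.
        (*) a ` elements V \<subseteq> (*) b ` elements V \<or> (*) b ` elements V \<subseteq> (*) a ` elements V)"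

definition gr_valuation_overring ::
  "('g::ab_group_add, 'a::field) graded_ring \<Rightarrow> 'a set \<Rightarrow> bool" where
  "gr_valuation_overring R V \<longleftrightarrow>
     homogeneous_overring R V \<and> gr_valuation_domain (overring_grading R V)"

text \<open>
  An isomorphism of graded rings, including an isomorphism of the grading monoids.  It is used
  to speak about extensions of \<open>R\<close> whose elements and degrees live in other types.
\<close>

definition graded_isomorphic ::
  "('g::ab_group_add, 'a::idom) graded_ring \<Rightarrow> ('h::ab_group_add, 'b::idom) graded_ring \<Rightarrow> bool"
  where
  "graded_isomorphic R S \<longleftrightarrow>
     (\<exists>\<phi> \<psi>. bij_betw \<phi> (elements R) (elements S) \<and> \<phi> 1 = 1 \<and>
        (\<forall>x\<in>elements R. \<forall>y\<in>elements R. \<phi> (x + y) = \<phi> x + \<phi> y \<and> \<phi> (x * y) = \<phi> x * \<phi> y) \<and>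
        bij_betw \<psi> (degrees R) (degrees S) \<and>
        (\<forall>a\<in>degrees R. \<forall>b\<in>degrees R. \<psi> (a + b) = \<psi> a + \<psi> b) \<and>
        (\<forall>a\<in>degrees R. \<phi> ` component R a = component S (\<psi> a)))"

end

theory Submission
  imports Defs
begin

text \<open>
  The proof replaces the four conditions by a single one that only involves elements of \<open>R\<close>
  (\<open>going_down_integral\<close>): for homogeneous primes \<open>P\<^sub>0 \<subseteq> P\<close> of \<open>R\<close> and homogeneous \<open>p \<in> P\<^sub>0\<close>, \<open>r \<notin> P\<^sub>0\<close>, the
  fraction \<open>p / r\<close> satisfies an equation of integral dependence over the localization of \<open>R\<close> at \<open>P\<close>
  whose lower coefficients belong to the extension of \<open>P\<close>.

  A gGD domain satisfies the conditions on simple overrings and on gr-valuation overrings because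
  these are homogeneous overrings, and each of the two conditions implies the one above.  If \<open>p / r\<close>
  has no such equation, put \<open>u = r / p\<close>.  Then the extension of \<open>P\<close> to \<open>R[u]\<close> contains no
  homogeneous element of \<open>R\<close> outside \<open>P\<close> (\<open>survives_adjoin_fraction\<close>), and \<open>R[u]\<close> is contained in a
  gr-valuation overring with the same property (\<open>exists_surviving_gr_valuation_overring\<close>).  In
  either of these two rings some homogeneous prime lies over \<open>P\<close>.  Going down to \<open>P\<^sub>0\<close> would put
  \<open>r = p u\<close> into \<open>P\<^sub>0\<close> (\<open>gGD_no_fraction\<close>), a contradiction.

  Conversely, suppose that \<open>R\<close> satisfies the intrinsic condition, and let \<open>T\<close> be any graded domain
  containing \<open>R\<close> (a homogeneous overring, for instance), with a homogeneous prime \<open>Q\<close> over \<open>P\<close>.  By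
  the usual maximality argument (\<open>exists_homogeneous_prime\<close>), a homogeneous prime inside \<open>Q\<close> and over
  \<open>P\<^sub>0\<close> exists unless \<open>r s\<close> lies in the extension of \<open>P\<^sub>0\<close> to \<open>T\<close> for some homogeneous \<open>r \<notin> P\<^sub>0\<close> in \<open>R\<close>
  and \<open>s \<notin> Q\<close> in \<open>T\<close>.  In that case \<open>s\<close> is a \<open>T\<close>-linear combination of fractions \<open>p / r\<close>, hence
  integral over the maximal ideal of the localization of \<open>T\<close> at \<open>Q\<close>, hence in \<open>Q\<close>
  (\<open>integral_combination_in_prime\<close>).  This step is a computation with finitely generated modules
  and Nakayama's lemma.  It takes place inside the domain \<open>T\<close>, so that no quotient field of \<open>T\<close>
  enters, and isomorphic copies of \<open>R\<close> in other types are covered as well.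

  The order on the grading monoid enters only through the fact that primality of a homogeneous
  ideal can be tested on homogeneous elements (\<open>homogeneous_primeI\<close>).
\<close>

section \<open>Sums of homogeneous elements\<close>

inductive_set sums_of :: "'a::comm_monoid_add set \<Rightarrow> 'a set" for X where
  zero [intro, simp]: "0 \<in> sums_of X"
| add: "x \<in> X \<Longrightarrow> y \<in> sums_of X \<Longrightarrow> x + y \<in> sums_of X"

lemma sums_of_incl: "x \<in> X \<Longrightarrow> x \<in> sums_of X"
  using sums_of.add[of x X 0] by simp

lemma sums_of_add: "x \<in> sums_of X \<Longrightarrow> y \<in> sums_of X \<Longrightarrow> x + y \<in> sums_of X"
  by (induction rule: sums_of.induct) (auto simp: add.assoc intro: sums_of.add)

lemma sums_of_least:
  assumes "X \<subseteq> A" "0 \<in> A" "\<And>x y. x \<in> A \<Longrightarrow> y \<in> A \<Longrightarrow> x + y \<in> A"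
  shows "sums_of X \<subseteq> A"
proof
  fix x assume "x \<in> sums_of X"
  then show "x \<in> A" by induction (use assms in auto)
qed

lemma sums_of_mono: "X \<subseteq> Y \<Longrightarrow> sums_of X \<subseteq> sums_of Y"
  by (rule sums_of_least) (auto intro: sums_of_incl sums_of_add)

lemma sums_of_sum: "(\<And>i. i \<in> F \<Longrightarrow> f i \<in> sums_of X) \<Longrightarrow> (\<Sum>i\<in>F. f i) \<in> sums_of X"
  by (induction F rule: infinite_finite_induct) (auto intro: sums_of_add)

lemma sums_of_map:
  assumes "x \<in> sums_of X" "f 0 \<in> sums_of Y" "\<And>x y. f (x + y) = f x + f y"
    "\<And>x. x \<in> X \<Longrightarrow> f x \<in> sums_of Y"
  shows "f x \<in> sums_of Y"
  using assms(1) by induction (use assms(2-) in \<open>auto intro: sums_of_add\<close>)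

lemma sums_of_mult_left:
  fixes c :: "'a::comm_ring_1"
  assumes "x \<in> sums_of X" "\<And>x. x \<in> X \<Longrightarrow> c * x \<in> sums_of Y"
  shows "c * x \<in> sums_of Y"
  by (rule sums_of_map[OF assms(1), of "\<lambda>x. c * x"]) (use assms(2) in \<open>auto simp: distrib_left\<close>)

lemma sums_of_mult:
  fixes x y :: "'a::comm_ring_1"
  assumes "x \<in> sums_of X" "y \<in> sums_of Y"
    "\<And>x y. x \<in> X \<Longrightarrow> y \<in> Y \<Longrightarrow> x * y \<in> sums_of Z"
  shows "x * y \<in> sums_of Z"
proof -
  have "y * x \<in> sums_of Z"
  proof (rule sums_of_mult_left[OF assms(1)])
    fix x assume "x \<in> X"
    then have "x * y \<in> sums_of Z"
      by (intro sums_of_mult_left[OF assms(2)] assms(3))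
    then show "y * x \<in> sums_of Z" by (simp add: mult.commute)
  qed
  then show ?thesis by (simp add: mult.commute)
qed

section \<open>Direct sums\<close>

lemma sums_of_UN_iff:
  fixes C :: "'g \<Rightarrow> 'a::ab_group_add set"
  assumes C: "\<And>g. g \<in> M \<Longrightarrow> 0 \<in> C g \<and> (\<forall>x\<in>C g. \<forall>y\<in>C g. x - y \<in> C g)"
  shows "sums_of (\<Union>g\<in>M. C g)
    = {\<Sum>g\<in>F. x g | F x. finite F \<and> F \<subseteq> M \<and> (\<forall>g\<in>F. x g \<in> C g)}" (is "?L = ?R")
proof
  show "?L \<subseteq> ?R"
  proof
    fix z assume "z \<in> ?L"
    then show "z \<in> ?R"
    proof induction
      case zero
      show ?case by (rule CollectI, rule exI[of _ "{}"]) auto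
    next
      case (add z y)
      obtain F x where F: "finite F" "F \<subseteq> M" "\<forall>g\<in>F. x g \<in> C g" "y = (\<Sum>g\<in>F. x g)"
        using add.IH by blast
      obtain h where h: "h \<in> M" "z \<in> C h" using add.hyps by blast
      have plus: "a + b \<in> C h" if "a \<in> C h" "b \<in> C h" for a b
        using C[OF h(1)] that by (metis diff_0 diff_minus_eq_add)
      let ?x = "\<lambda>g. (if g = h then z else 0) + (if g \<in> F then x g else 0)"
      have "(\<Sum>g\<in>insert h F. ?x g) = z + (\<Sum>g\<in>insert h F. if g \<in> F then x g else 0)"
        using F(1) by (simp add: sum.distrib)
      also have "(\<Sum>g\<in>insert h F. if g \<in> F then x g else 0) = (\<Sum>g\<in>F. x g)"
        using F(1) by (intro sum.mono_neutral_cong_right) auto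
      finally have "z + y = (\<Sum>g\<in>insert h F. ?x g)" using F(4) by simp
      moreover have "\<forall>g\<in>insert h F. ?x g \<in> C g" using F h C plus by auto
      ultimately show ?case using F h
        by (intro CollectI exI[of _ "insert h F"] exI[of _ ?x]) auto
    qed
  qed
  show "?R \<subseteq> ?L"
  proof clarify
    fix F x assume "F \<subseteq> M" "\<forall>g\<in>F. x g \<in> C g"
    then show "(\<Sum>g\<in>F. x g) \<in> ?L" by (intro sums_of_sum sums_of_incl) auto
  qed
qed

lemma internal_direct_sum_iff:
  "internal_direct_sum M C S \<longleftrightarrow>
     (\<forall>g\<in>M. 0 \<in> C g \<and> (\<forall>x\<in>C g. \<forall>y\<in>C g. x - y \<in> C g)) \<and>
     S = sums_of (\<Union>g\<in>M. C g) \<and>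
     (\<forall>F x. finite F \<and> F \<subseteq> M \<and> (\<forall>g\<in>F. x g \<in> C g) \<and> (\<Sum>g\<in>F. x g) = 0
        \<longrightarrow> (\<forall>g\<in>F. x g = 0))"
  unfolding internal_direct_sum_def by (rule conj_cong[OF refl]) (subst sums_of_UN_iff[of M C], simp_all)

section \<open>Graded domains\<close>

definition homog :: "('g, 'a::idom) graded_ring \<Rightarrow> 'a set" where
  "homog T = (\<Union>g\<in>degrees T. component T g)"

lemma subring_setD:
  assumes "subring_set S"
  shows "1 \<in> S" "0 \<in> S" "x \<in> S \<Longrightarrow> y \<in> S \<Longrightarrow> x - y \<in> S" "x \<in> S \<Longrightarrow> y \<in> S \<Longrightarrow> x * y \<in> S"
    "x \<in> S \<Longrightarrow> - x \<in> S" "x \<in> S \<Longrightarrow> y \<in> S \<Longrightarrow> x + y \<in> S" "x \<in> S \<Longrightarrow> x ^ n \<in> S"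
proof -
  show d: "x - y \<in> S" and m: "x * y \<in> S" if "x \<in> S" "y \<in> S" for x y
    using assms that unfolding subring_set_def by auto
  show 1: "1 \<in> S" using assms unfolding subring_set_def by auto
  show z: "0 \<in> S" using d[OF 1 1] by simp
  show n: "- x \<in> S" if "x \<in> S" for x using d[OF z that] by simp
  show "x + y \<in> S" if "x \<in> S" "y \<in> S" for x y using d[OF that(1) n[OF that(2)]] by simp
  show "x ^ n \<in> S" if "x \<in> S" for x using that by (induction n) (auto intro: 1 m)
qed

lemma subring_set_sum:
  assumes "subring_set S" "\<And>i. i \<in> F \<Longrightarrow> f i \<in> S"
  shows "(\<Sum>i\<in>F. f i) \<in> S"
  using assms(2) by (induction F rule: infinite_finite_induct) (auto intro: subring_setD[OF assms(1)])

lemma ideal_ofD: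
  assumes "ideal_of S I"
  shows "I \<subseteq> S" "0 \<in> I" "x \<in> I \<Longrightarrow> y \<in> I \<Longrightarrow> x + y \<in> I" "s \<in> S \<Longrightarrow> x \<in> I \<Longrightarrow> s * x \<in> I"
    "s \<in> S \<Longrightarrow> x \<in> I \<Longrightarrow> x * s \<in> I"
  using assms unfolding ideal_of_def by (auto simp: mult.commute)

lemma ideal_of_diff:
  assumes "subring_set S" "ideal_of S I" "x \<in> I" "y \<in> I"
  shows "x - y \<in> I" "- y \<in> I"
proof -
  have "-1 \<in> S" using subring_setD[OF assms(1)] by blast
  then show "- y \<in> I" using ideal_ofD(4)[OF assms(2) _ assms(4)] by fastforce
  then show "x - y \<in> I" using ideal_ofD(3)[OF assms(2,3)] by fastforce
qed

lemma ideal_of_sum: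
  assumes "ideal_of S I" "\<And>i. i \<in> F \<Longrightarrow> f i \<in> I"
  shows "(\<Sum>i\<in>F. f i) \<in> I"
  using assms(2) by (induction F rule: infinite_finite_induct) (auto intro: ideal_ofD[OF assms(1)])

lemma ideal_of_sums_of: "ideal_of S I \<Longrightarrow> X \<subseteq> I \<Longrightarrow> sums_of X \<subseteq> I"
  by (rule sums_of_least) (auto intro: ideal_ofD)

lemma prime_ideal_ofD:
  assumes "prime_ideal_of S P"
  shows "ideal_of S P" "P \<noteq> S" "x \<in> S \<Longrightarrow> y \<in> S \<Longrightarrow> x * y \<in> P \<Longrightarrow> x \<in> P \<or> y \<in> P"
  using assms unfolding prime_ideal_of_def by auto

lemma prime_ideal_not_one: "prime_ideal_of S P \<Longrightarrow> 1 \<notin> P"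
  using prime_ideal_ofD[of S P] ideal_ofD[of S P] by (metis mult.right_neutral subsetI subset_antisym)

lemma prime_ideal_power: "subring_set S \<Longrightarrow> prime_ideal_of S P \<Longrightarrow> x \<in> S \<Longrightarrow> x ^ n \<in> P \<Longrightarrow> x \<in> P"
proof (induction n)
  case 0 then show ?case using prime_ideal_not_one by auto
next
  case (Suc n) then show ?case
    using prime_ideal_ofD(3)[of S P x "x ^ n"] subring_setD(7)[of S x n] by auto
qed

context
  fixes T :: "('g::ab_group_add, 'a::idom) graded_ring"
  assumes T: "graded_domain T"
begin

lemma gd_monoid: "torsionless_monoid (degrees T)" "degrees T \<noteq> {0}"
  and gd_subring: "subring_set (elements T)"
  and gd_zero: "g \<in> degrees T \<Longrightarrow> 0 \<in> component T g"
  and gd_diff: "g \<in> degrees T \<Longrightarrow> x \<in> component T g \<Longrightarrow> y \<in> component T g \<Longrightarrow> x - y \<in> component T g"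
  and gd_mult: "g \<in> degrees T \<Longrightarrow> h \<in> degrees T \<Longrightarrow> x \<in> component T g \<Longrightarrow> y \<in> component T h
      \<Longrightarrow> x * y \<in> component T (g + h)"
  and gd_elements: "elements T = sums_of (homog T)"
  and gd_indep: "finite F \<Longrightarrow> F \<subseteq> degrees T \<Longrightarrow> (\<And>g. g \<in> F \<Longrightarrow> c g \<in> component T g)
      \<Longrightarrow> (\<Sum>g\<in>F. c g) = 0 \<Longrightarrow> g \<in> F \<Longrightarrow> c g = 0"
proof -
  have parts: "torsionless_monoid (degrees T)" "degrees T \<noteq> {0}" "subring_set (elements T)"
    "\<forall>g\<in>degrees T. 0 \<in> component T g \<and> (\<forall>x\<in>component T g. \<forall>y\<in>component T g. x - y \<in> component T g)"
    "elements T = sums_of (\<Union>g\<in>degrees T. component T g)"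
    "\<forall>a\<in>degrees T. \<forall>b\<in>degrees T. \<forall>x\<in>component T a. \<forall>y\<in>component T b. x * y \<in> component T (a + b)"
    using T [unfolded graded_domain_def internal_direct_sum_iff] by argo+
  show "torsionless_monoid (degrees T)" "degrees T \<noteq> {0}" "subring_set (elements T)"
    "g \<in> degrees T \<Longrightarrow> 0 \<in> component T g"
    "g \<in> degrees T \<Longrightarrow> x \<in> component T g \<Longrightarrow> y \<in> component T g \<Longrightarrow> x - y \<in> component T g"
    "g \<in> degrees T \<Longrightarrow> h \<in> degrees T \<Longrightarrow> x \<in> component T g \<Longrightarrow> y \<in> component T h
      \<Longrightarrow> x * y \<in> component T (g + h)"
    "elements T = sums_of (homog T)"
    unfolding homog_def by (use parts in \<open>argo | blast\<close>)+
  have "\<forall>F x. finite F \<and> F \<subseteq> degrees T \<and> (\<forall>g\<in>F. x g \<in> component T g) \<and> (\<Sum>g\<in>F. x g) = 0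
        \<longrightarrow> (\<forall>g\<in>F. x g = 0)"
    using T [unfolded graded_domain_def internal_direct_sum_iff] by argo
  from this [rule_format, of F c g] show "finite F \<Longrightarrow> F \<subseteq> degrees T \<Longrightarrow> (\<And>g. g \<in> F \<Longrightarrow> c g \<in> component T g)
      \<Longrightarrow> (\<Sum>g\<in>F. c g) = 0 \<Longrightarrow> g \<in> F \<Longrightarrow> c g = 0"
    by blast
qed

lemma gd_degree_zero: "0 \<in> degrees T" and gd_degree_add: "g \<in> degrees T \<Longrightarrow> h \<in> degrees T \<Longrightarrow> g + h \<in> degrees T"
  using gd_monoid unfolding torsionless_monoid_def by auto

lemma gd_uminus: "g \<in> degrees T \<Longrightarrow> x \<in> component T g \<Longrightarrow> - x \<in> component T g"
  using gd_diff[of g 0 x] gd_zero[of g] by simp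

lemma homog_elements: "homog T \<subseteq> elements T"
  using gd_elements sums_of_incl by blast

lemma homog_mult: "x \<in> homog T \<Longrightarrow> y \<in> homog T \<Longrightarrow> x * y \<in> homog T"
  unfolding homog_def by clarify (rule UN_I, erule (1) gd_degree_add, erule (3) gd_mult)

lemma gd_decompose:
  assumes "x \<in> elements T"
  obtains F c where "finite F" "F \<subseteq> degrees T" "\<And>g. g \<in> F \<Longrightarrow> c g \<in> component T g" "x = (\<Sum>g\<in>F. c g)"
proof -
  have "x \<in> {\<Sum>g\<in>F. c g | F c. finite F \<and> F \<subseteq> degrees T \<and> (\<forall>g\<in>F. c g \<in> component T g)}"
    using assms unfolding gd_elements homog_def
    by (subst sums_of_UN_iff[symmetric]) (use gd_zero gd_diff in auto)
  then show ?thesis using that by blast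
qed

text \<open>
  Homogeneous ideals are used only through this criterion.  The sums of homogeneous elements of an
  ideal \<open>I\<close> form an ideal again, so they exhaust \<open>I\<close> as soon as \<open>I\<close> has homogeneous generators.
\<close>

lemma homogeneous_ideal_iff:
  "homogeneous_ideal T I \<longleftrightarrow> ideal_of (elements T) I \<and> I \<subseteq> sums_of (I \<inter> homog T)"
proof
  assume h: "homogeneous_ideal T I"
  then obtain G where G: "ideal_of (elements T) I" "G \<subseteq> nz_homogeneous T"
    "I = ideal_of (elements T) hull G"
    unfolding homogeneous_ideal_def by auto
  have GI: "G \<subseteq> I" unfolding G(3) by (rule hull_subset)
  have GH: "G \<subseteq> homog T" using G(2) unfolding nz_homogeneous_def homog_def by auto
  let ?J = "sums_of (I \<inter> homog T)"
  have "ideal_of (elements T) ?J"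
    unfolding ideal_of_def
  proof (intro conjI ballI)
    have "?J \<subseteq> I" by (rule ideal_of_sums_of[OF G(1)]) auto
    then show "?J \<subseteq> elements T" using ideal_ofD(1)[OF G(1)] by blast
    fix s x assume s: "s \<in> elements T" and x: "x \<in> ?J"
    show "s * x \<in> ?J"
      by (rule sums_of_mult[OF s[unfolded gd_elements] x])
        (use homog_elements in \<open>auto intro!: sums_of_incl homog_mult ideal_ofD(4)[OF G(1)]\<close>)
  qed (auto intro: sums_of_add)
  then have "ideal_of (elements T) hull G \<subseteq> ?J"
    by (rule hull_minimal[rotated]) (use GI GH in \<open>auto intro: sums_of_incl\<close>)
  then show "ideal_of (elements T) I \<and> I \<subseteq> sums_of (I \<inter> homog T)" using G by auto
next
  assume h: "ideal_of (elements T) I \<and> I \<subseteq> sums_of (I \<inter> homog T)"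
  let ?G = "I \<inter> nz_homogeneous T"
  have "I = ideal_of (elements T) hull ?G"
  proof
    show "ideal_of (elements T) hull ?G \<subseteq> I" by (rule hull_minimal) (use h in auto)
    show "I \<subseteq> ideal_of (elements T) hull ?G"
      unfolding hull_def
    proof (rule Inter_greatest)
      fix K assume "K \<in> {t. ideal_of (elements T) t \<and> ?G \<subseteq> t}"
      then have K: "ideal_of (elements T) K" "?G \<subseteq> K" by auto
      have "I \<inter> homog T \<subseteq> K"
        using K(2) ideal_ofD(2)[OF K(1)] unfolding nz_homogeneous_def homog_def by auto
      then show "I \<subseteq> K" using ideal_of_sums_of[OF K(1)] h by blast
    qed
  qed
  then show "homogeneous_ideal T I" using h unfolding homogeneous_ideal_def by blast
qed

text \<open>
  Membership of a sum in a homogeneous ideal can be tested degree by degree: the sum has a second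
  decomposition, into homogeneous elements of the ideal, and the two agree by independence.
\<close>

lemma homogeneous_ideal_component:
  assumes I: "homogeneous_ideal T I" and F: "finite F" "F \<subseteq> degrees T"
    "\<And>g. g \<in> F \<Longrightarrow> c g \<in> component T g" "(\<Sum>g\<in>F. c g) \<in> I" "g \<in> F"
  shows "c g \<in> I"
proof -
  have idl: "ideal_of (elements T) I" and I2: "I \<subseteq> sums_of (I \<inter> homog T)"
    using I unfolding homogeneous_ideal_iff by auto
  have "I \<inter> homog T = (\<Union>g\<in>degrees T. I \<inter> component T g)" unfolding homog_def by auto
  with F(4) I2 have "(\<Sum>g\<in>F. c g) \<in> sums_of (\<Union>g\<in>degrees T. I \<inter> component T g)" by auto
  then have "(\<Sum>g\<in>F. c g) \<in> {\<Sum>g\<in>F. x g | F x. finite F \<and> F \<subseteq> degrees T \<and> (\<forall>g\<in>F. x g \<in> I \<inter> component T g)}"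
    by (subst sums_of_UN_iff[symmetric])
      (use gd_zero gd_diff ideal_ofD[OF idl] ideal_of_diff[OF gd_subring idl] in auto)
  then obtain F' b where F': "finite F'" "F' \<subseteq> degrees T" "\<And>g. g \<in> F' \<Longrightarrow> b g \<in> I \<inter> component T g"
     "(\<Sum>g\<in>F. c g) = (\<Sum>g\<in>F'. b g)" by blast
  let ?c = "\<lambda>g. if g \<in> F then c g else 0" and ?b = "\<lambda>g. if g \<in> F' then b g else 0"
  have "(\<Sum>g\<in>F\<union>F'. ?c g) = (\<Sum>g\<in>F. c g)"
    using F F' by (intro sum.mono_neutral_cong_right) auto
  moreover have "(\<Sum>g\<in>F\<union>F'. ?b g) = (\<Sum>g\<in>F'. b g)"
    using F F' by (intro sum.mono_neutral_cong_right) auto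
  ultimately have "(\<Sum>g\<in>F\<union>F'. ?c g - ?b g) = 0" using F'(4) by (simp add: sum_subtractf)
  then have "?c g - ?b g = 0"
    by (rule gd_indep[rotated 3, of _ "F \<union> F'" g])
      (use F F' gd_zero in \<open>auto intro!: gd_diff gd_uminus intro: gd_zero\<close>)
  then have "c g = ?b g" using F(5) by simp
  then show ?thesis using F'(3)[of g] ideal_ofD(2)[OF idl] by (cases "g \<in> F'") auto
qed

lemma homogeneous_ideal_isolate:
  assumes I: "homogeneous_ideal T I" and k: "k \<in> degrees T" "a \<in> component T k"
    and K: "K \<subseteq> degrees T" "k \<notin> K" "t \<in> sums_of (\<Union>g\<in>K. component T g)" and "a + t \<in> I"
  shows "a \<in> I"
proof -
  have "t \<in> {\<Sum>g\<in>F. x g | F x. finite F \<and> F \<subseteq> K \<and> (\<forall>g\<in>F. x g \<in> component T g)}"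
    by (subst sums_of_UN_iff[symmetric]) (use K gd_zero gd_diff in auto)
  then obtain F c where F: "finite F" "F \<subseteq> K" "\<And>g. g \<in> F \<Longrightarrow> c g \<in> component T g" "t = (\<Sum>g\<in>F. c g)"
    by blast
  let ?c = "\<lambda>g. if g = k then a else c g"
  have sum: "(\<Sum>g\<in>insert k F. ?c g) = a + t"
    using F(1,2,4) K(2) by (subst sum.insert) (auto intro!: sum.cong)
  have "?c k \<in> I"
  proof (rule homogeneous_ideal_component[OF I, of "insert k F" ?c])
    show "finite (insert k F)" "insert k F \<subseteq> degrees T" using F(1,2) k K(1) by auto
    show "?c g \<in> component T g" if "g \<in> insert k F" for g
      using that F(3) k(2) by (cases "g = k") auto
    show "(\<Sum>g\<in>insert k F. ?c g) \<in> I" using \<open>a + t \<in> I\<close> sum by simp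
  qed simp
  then show ?thesis by simp
qed

end

lemma homogeneous_primeD:
  assumes "graded_domain T" "homogeneous_prime T P"
  shows "homogeneous_ideal T P" "prime_ideal_of (elements T) P" "ideal_of (elements T) P"
    "P \<subseteq> sums_of (P \<inter> homog T)" "P \<subseteq> elements T" "P \<noteq> elements T"
  using assms homogeneous_ideal_iff[OF assms(1), of P] prime_ideal_ofD[of "elements T" P] ideal_ofD(1)[of "elements T" P]
  unfolding homogeneous_prime_def by auto

lemma homogeneous_prime_subset:
  assumes T: "graded_domain T" "homogeneous_ideal T P" and "P \<inter> homog T \<subseteq> I" "ideal_of S I"
  shows "P \<subseteq> I"
  using assms homogeneous_ideal_iff[OF assms(1), of P] ideal_of_sums_of[of S I "P \<inter> homog T"] by auto

lemma homog_outside_prime: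
  assumes "graded_domain T" "homogeneous_prime T P"
  obtains s where "s \<in> homog T" "s \<notin> P"
proof (atomize_elim, rule ccontr)
  assume "\<nexists>s. s \<in> homog T \<and> s \<notin> P"
  then have "elements T \<subseteq> P"
    using ideal_of_sums_of[OF homogeneous_primeD(3)[OF assms], of "homog T"] gd_elements[OF assms(1)] by auto
  then show False using homogeneous_primeD(5,6)[OF assms] by auto
qed

section \<open>Homogeneous prime ideals\<close>

lemma sum_lessThan_mult: "(\<Sum>i<(m * n::nat). a) = (\<Sum>i<m. \<Sum>j<n. a::'g::ab_group_add)"
proof (induction m)
  case (Suc m)
  have plus: "(\<Sum>i<k + l. a) = (\<Sum>i<k. a) + (\<Sum>i<l. a)" for k l :: nat
    by (induction l) (auto simp: add.assoc)
  show ?case using Suc plus[of "m * n" n] by (simp add: add.commute)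
qed simp

text \<open>
  A torsionless monoid carries a compatible total order: a maximal set of positive elements \<open>N\<close>
  contains \<open>x\<close> or \<open>- x\<close> for every \<open>x\<close> of infinite order, since otherwise adjoining either of them
  produces zero, \<open>p + n x = 0 = q - m x\<close>, whence \<open>m p + n q = 0\<close>, which forces \<open>p = q = 0\<close> and
  \<open>n x = 0\<close>.
\<close>

lemma exists_positive_cone:
  obtains N :: "'g::ab_group_add set" where "0 \<notin> N" "\<And>a b. a \<in> N \<Longrightarrow> b \<in> N \<Longrightarrow> a + b \<in> N"
    "\<And>x. (\<And>n. n > 0 \<Longrightarrow> (\<Sum>i<(n::nat). x) = 0 \<Longrightarrow> False) \<Longrightarrow> x \<in> N \<or> - x \<in> N"
proof -
  define \<A> where "\<A> = {N::'g set. 0 \<notin> N \<and> (\<forall>a\<in>N. \<forall>b\<in>N. a + b \<in> N)}"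
  have "\<exists>N\<in>\<A>. \<forall>X\<in>\<A>. N \<subseteq> X \<longrightarrow> X = N"
  proof (rule subset_Zorn')
    fix \<C> assume "subset.chain \<A> \<C>"
    then have ch: "\<C> \<subseteq> \<A>" "\<And>X Y. X \<in> \<C> \<Longrightarrow> Y \<in> \<C> \<Longrightarrow> X \<subseteq> Y \<or> Y \<subseteq> X"
      unfolding subset_chain_def by auto
    show "\<Union>\<C> \<in> \<A>"
      unfolding \<A>_def
    proof (intro CollectI conjI ballI)
      show "0 \<notin> \<Union>\<C>" using ch(1) unfolding \<A>_def by auto
      fix a b assume "a \<in> \<Union>\<C>" "b \<in> \<Union>\<C>"
      then obtain X where "X \<in> \<C>" "a \<in> X" "b \<in> X" using ch(2) by blast
      then show "a + b \<in> \<Union>\<C>" using ch(1) unfolding \<A>_def by blast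
    qed
  qed
  then obtain N where N: "N \<in> \<A>" and max: "\<And>X. X \<in> \<A> \<Longrightarrow> N \<subseteq> X \<Longrightarrow> X = N" by auto
  have zero: "0 \<notin> N" and plus: "\<And>a b. a \<in> N \<Longrightarrow> b \<in> N \<Longrightarrow> a + b \<in> N"
    using N unfolding \<A>_def by auto
  have plus0: "a + b \<in> insert 0 N" if "a \<in> insert 0 N" "b \<in> insert 0 N" for a b
    using that plus by auto
  have mult0: "(\<Sum>i<(n::nat). a) \<in> insert 0 N" if "a \<in> insert 0 N" for a n
    by (induction n) (use that in \<open>auto intro: plus\<close>)
  have mult: "(\<Sum>i<(n::nat). a) \<in> N" if "a \<in> N" "n > 0" for a n
    using that(2) by (induction n rule: nat_induct_non_zero) (use that plus in auto)
  have adjoin: "\<exists>p\<in>insert 0 N. \<exists>n>0. p + (\<Sum>i<(n::nat). x) = 0" if "x \<notin> N" for x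
  proof (rule ccontr)
    assume none: "\<not> ?thesis"
    let ?X = "N \<union> {p + (\<Sum>i<n. x) | p n. p \<in> insert 0 N \<and> n > (0::nat)}"
    have "?X \<in> \<A>"
      unfolding \<A>_def
    proof (intro CollectI conjI ballI)
      show "0 \<notin> ?X"
      proof
        assume "0 \<in> ?X"
        with zero obtain p and n :: nat where pn: "0 = p + (\<Sum>i<n. x)" "p \<in> insert 0 N" "n > 0" by auto
        from pn(1)[symmetric] pn(2,3) none show False by blast
      qed
      have split: "\<exists>p n. a = p + (\<Sum>i<(n::nat). x) \<and> p \<in> insert 0 N \<and> (n > 0 \<or> p \<in> N)" if "a \<in> ?X" for a
      proof (cases "a \<in> N")
        case True then show ?thesis by (intro exI[of _ a] exI[of _ 0]) auto
      next
        case False then show ?thesis using that by auto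
      qed
      fix a b assume "a \<in> ?X" "b \<in> ?X"
      then obtain p n q m where pq: "a = p + (\<Sum>i<(n::nat). x)" "p \<in> insert 0 N" "n > 0 \<or> p \<in> N"
        "b = q + (\<Sum>i<(m::nat). x)" "q \<in> insert 0 N" "m > 0 \<or> q \<in> N"
        using split[of a] split[of b] by blast
      have "(\<Sum>i<n + m. x) = (\<Sum>i<n. x) + (\<Sum>i<m. x)"
        by (induction m) (auto simp: add.assoc)
      then have ab: "a + b = (p + q) + (\<Sum>i<n + m. x)" using pq by (simp add: algebra_simps)
      show "a + b \<in> ?X"
      proof (cases "n + m > 0")
        case True
        then show ?thesis using ab plus0[OF pq(2,5)] by blast
      next
        case False
        then show ?thesis using pq plus by simp
      qed
    qed
    moreover have "x \<in> ?X" by (intro UnI2 CollectI exI[of _ 0] exI[of _ "1::nat"]) auto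
    ultimately show False using max[of ?X] that by blast
  qed
  show ?thesis
  proof (rule that[OF zero plus])
    fix x :: 'g assume tf: "\<And>n. n > 0 \<Longrightarrow> (\<Sum>i<(n::nat). x) = 0 \<Longrightarrow> False"
    show "x \<in> N \<or> - x \<in> N"
    proof (rule ccontr)
      assume "\<not> ?thesis"
      then obtain p n q m where p: "p \<in> insert 0 N" "n > 0" "p + (\<Sum>i<(n::nat). x) = 0"
        and q: "q \<in> insert 0 N" "m > 0" "q + (\<Sum>i<(m::nat). - x) = 0"
        using adjoin[of x] adjoin[of "- x"] by blast
      have "(\<Sum>i<m. p + (\<Sum>i<n. x)) + (\<Sum>i<n. q + (\<Sum>i<m. - x)) = 0" using p q by simp
      moreover have "(\<Sum>i<m. \<Sum>i<n. x) = (\<Sum>i<n. \<Sum>i<m. x)"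
        using sum_lessThan_mult[where a=x] by (metis mult.commute)
      ultimately have pq: "(\<Sum>i<m. p) + (\<Sum>i<n. q) = 0"
        by (simp only: sum.distrib sum_negf) (simp add: algebra_simps)
      have "p = 0"
      proof (rule ccontr)
        assume "p \<noteq> 0"
        then have "(\<Sum>i<m. p) \<in> N" using mult p q by auto
        then have "(\<Sum>i<m. p) + (\<Sum>i<n. q) \<in> N" using mult0[OF q(1), of n] plus by auto
        then show False using pq zero by simp
      qed
      then show False using tf p by auto
    qed
  qed
qed

lemma torsionless_monoid_order:
  assumes "torsionless_monoid M"
  obtains N where "0 \<notin> N" "\<And>a b. a \<in> N \<Longrightarrow> b \<in> N \<Longrightarrow> a + b \<in> N"
    "\<And>g h. g \<in> M \<Longrightarrow> h \<in> M \<Longrightarrow> g \<noteq> h \<Longrightarrow> g - h \<in> N \<or> h - g \<in> N"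
proof (rule exists_positive_cone)
  fix N :: "'a set"
  assume N: "0 \<notin> N" "\<And>a b. a \<in> N \<Longrightarrow> b \<in> N \<Longrightarrow> a + b \<in> N"
    "\<And>x. (\<And>n. n > 0 \<Longrightarrow> (\<Sum>i<(n::nat). x) = 0 \<Longrightarrow> False) \<Longrightarrow> x \<in> N \<or> - x \<in> N"
  show thesis
  proof (rule that[OF N(1,2)])
    fix g h assume gh: "g \<in> M" "h \<in> M" "g \<noteq> h"
    have "False" if n: "n > 0" "(\<Sum>i<(n::nat). g - h) = 0" for n
    proof -
      have "(\<Sum>i<n. g) = (\<Sum>i<n. h)" using n(2) by (simp add: sum_subtractf)
      then show False using assms gh n(1) unfolding torsionless_monoid_def by blast
    qed
    then show "g - h \<in> N \<or> h - g \<in> N" using N(3)[of "g - h"] by auto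
  qed auto
qed

lemma finite_set_has_greatest:
  fixes N :: "'g::ab_group_add set"
  assumes "finite F" "F \<noteq> {}"
    and plus: "\<And>a b. a \<in> N \<Longrightarrow> b \<in> N \<Longrightarrow> a + b \<in> N"
    and total: "\<And>g h. g \<in> F \<Longrightarrow> h \<in> F \<Longrightarrow> g \<noteq> h \<Longrightarrow> g - h \<in> N \<or> h - g \<in> N"
  shows "\<exists>g\<in>F. \<forall>h\<in>F. h \<noteq> g \<longrightarrow> g - h \<in> N"
  using assms(1,2) total
proof (induction rule: finite_ne_induct)
  case (insert x F)
  then obtain g where g: "g \<in> F" "\<And>h. h \<in> F \<Longrightarrow> h \<noteq> g \<Longrightarrow> g - h \<in> N" by blast
  show ?case
  proof (cases "x - g \<in> N")
    case True
    have "x - h \<in> N" if "h \<in> F" for h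
      using True g(2)[OF that] plus[of "x - g" "g - h"] by (cases "h = g") auto
    then show ?thesis by auto
  next
    case False
    then have "x \<noteq> g \<longrightarrow> g - x \<in> N" using insert.prems[of x g] g(1) by auto
    then show ?thesis using g by auto
  qed
qed auto

text \<open>
  Modulo a homogeneous ideal, a nonzero element has a leading form with respect to a compatible
  order, and the leading form of a product is the product of the leading forms.  This is why it
  suffices to test primality on homogeneous elements.
\<close>

lemma leading_form:
  assumes T: "graded_domain T" and I: "ideal_of (elements T) I"
    and N: "\<And>a b. a \<in> N \<Longrightarrow> b \<in> N \<Longrightarrow> a + b \<in> N"
      "\<And>g h. g \<in> degrees T \<Longrightarrow> h \<in> degrees T \<Longrightarrow> g \<noteq> h \<Longrightarrow> g - h \<in> N \<or> h - g \<in> N"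
    and x: "x \<in> elements T" "x \<notin> I"
  obtains g a i t where "g \<in> degrees T" "a \<in> component T g" "a \<notin> I" "i \<in> I"
    "t \<in> sums_of (\<Union>h\<in>{h\<in>degrees T. g - h \<in> N}. component T h)" "x = i + a + t"
proof -
  obtain F c where F: "finite F" "F \<subseteq> degrees T" "\<And>g. g \<in> F \<Longrightarrow> c g \<in> component T g"
    "x = (\<Sum>g\<in>F. c g)" using gd_decompose[OF T x(1)] by blast
  let ?F = "{g\<in>F. c g \<notin> I}"
  have split: "x = (\<Sum>g\<in>F - ?F. c g) + (\<Sum>g\<in>?F. c g)"
    using F(1) by (simp add: F(4) sum.subset_diff[of ?F F])
  have i: "(\<Sum>g\<in>F - ?F. c g) \<in> I" by (rule ideal_of_sum[OF I]) auto
  have "?F \<noteq> {}"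
  proof
    assume "?F = {}"
    with split have "x = (\<Sum>g\<in>F - ?F. c g)" by (simp only: sum.empty add_0_right)
    then show False using i x(2) by simp
  qed
  with F N(2) obtain g where g: "g \<in> ?F" "\<And>h. h \<in> ?F \<Longrightarrow> h \<noteq> g \<Longrightarrow> g - h \<in> N"
    using finite_set_has_greatest[of ?F N, OF _ _ N(1)] by (auto simp: subset_iff)
  have "(\<Sum>g\<in>?F. c g) = c g + (\<Sum>g\<in>?F - {g}. c g)"
    using F(1) g(1) by (simp add: sum.remove)
  moreover have "(\<Sum>g\<in>?F - {g}. c g) \<in> sums_of (\<Union>h\<in>{h\<in>degrees T. g - h \<in> N}. component T h)"
    by (intro sums_of_sum sums_of_incl) (use g F in auto)
  ultimately show ?thesis
    using that[of g "c g" "\<Sum>g\<in>F - ?F. c g" "\<Sum>g\<in>?F - {g}. c g"] split i g(1) F(2,3)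
    by (auto simp: add.assoc)
qed

lemma homogeneous_primeI:
  assumes T: "graded_domain T" and I: "homogeneous_ideal T I" and ne: "I \<noteq> elements T"
    and pr: "\<And>a b. a \<in> homog T \<Longrightarrow> b \<in> homog T \<Longrightarrow> a * b \<in> I \<Longrightarrow> a \<in> I \<or> b \<in> I"
  shows "homogeneous_prime T I"
proof -
  have idl: "ideal_of (elements T) I" using I homogeneous_ideal_iff[OF T] by simp
  note R = gd_subring[OF T]
  obtain N where N: "0 \<notin> N" "\<And>a b. a \<in> N \<Longrightarrow> b \<in> N \<Longrightarrow> a + b \<in> N"
    "\<And>g h. g \<in> degrees T \<Longrightarrow> h \<in> degrees T \<Longrightarrow> g \<noteq> h \<Longrightarrow> g - h \<in> N \<or> h - g \<in> N"
    using torsionless_monoid_order[OF gd_monoid(1)[OF T]] by blast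
  define low where "low g = (\<Union>h\<in>{h\<in>degrees T. g - h \<in> N}. component T h)" for g
  have low: "x * y \<in> low (g + h)" if "x \<in> component T g" "g \<in> degrees T" "y \<in> low h" for x y g h
    using that gd_mult[OF T] gd_degree_add[OF T] unfolding low_def by force
  have low2: "x * y \<in> low (g + h)" if x: "x \<in> low g" and y: "y \<in> low h" for x y g h
  proof -
    obtain k l where "k \<in> degrees T" "l \<in> degrees T" "g - k \<in> N" "h - l \<in> N"
      "x \<in> component T k" "y \<in> component T l" using x y unfolding low_def by auto
    moreover from this have "(g + h) - (k + l) \<in> N" using N(2)[of "g - k" "h - l"] by (simp add: algebra_simps)
    ultimately show ?thesis using gd_mult[OF T, of k l x y] gd_degree_add[OF T, of k l]
      unfolding low_def by (intro UN_I[of "k + l"]) auto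
  qed
  have low_elements: "sums_of (low g) \<subseteq> elements T" for g
    unfolding gd_elements[OF T] by (rule sums_of_mono) (auto simp: low_def homog_def)
  have "x \<in> I \<or> y \<in> I" if xy: "x \<in> elements T" "y \<in> elements T" "x * y \<in> I" for x y
  proof (rule ccontr)
    assume neg: "\<not> (x \<in> I \<or> y \<in> I)"
    obtain g a i t where x: "g \<in> degrees T" "a \<in> component T g" "a \<notin> I" "i \<in> I"
      "t \<in> sums_of (low g)" "x = i + a + t"
      by (rule leading_form[OF T idl N(2,3) xy(1), folded low_def]) (use neg in blast)+
    obtain h b j u where y: "h \<in> degrees T" "b \<in> component T h" "b \<notin> I" "j \<in> I"
      "u \<in> sums_of (low h)" "y = j + b + u"
      by (rule leading_form[OF T idl N(2,3) xy(2), folded low_def]) (use neg in blast)+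
    have hom: "a \<in> homog T" "b \<in> homog T" using x y unfolding homog_def by auto
    have el: "a \<in> elements T" "t \<in> elements T" "b \<in> elements T" "u \<in> elements T" "j \<in> elements T"
      using homog_elements[OF T] hom low_elements x(5) y(4,5) ideal_ofD(1)[OF idl] by auto
    have rest: "a * u + b * t + t * u \<in> sums_of (low (g + h))"
    proof (intro sums_of_add)
      show "a * u \<in> sums_of (low (g + h))"
        by (rule sums_of_mult_left[OF y(5)]) (use low x in \<open>auto intro: sums_of_incl\<close>)
      show "b * t \<in> sums_of (low (g + h))"
        by (rule sums_of_mult_left[OF x(5)]) (use low[of b h _ g] y in \<open>auto intro: sums_of_incl simp: add.commute\<close>)
      show "t * u \<in> sums_of (low (g + h))"
        by (rule sums_of_mult[OF x(5) y(5)]) (use low2 in \<open>auto intro: sums_of_incl\<close>)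
    qed
    have "i * y + (a + t) * j \<in> I"
      by (intro ideal_ofD(3,4,5)[OF idl] xy x y subring_setD[OF R] el)
    then have "x * y - (i * y + (a + t) * j) \<in> I"
      using ideal_of_diff(1)[OF R idl xy(3)] by blast
    moreover have "x * y - (i * y + (a + t) * j) = a * b + (a * u + b * t + t * u)"
      by (simp add: x(6) y(6) algebra_simps)
    ultimately have "a * b + (a * u + b * t + t * u) \<in> I" by simp
    then have "a * b \<in> I"
      using homogeneous_ideal_isolate[OF T I gd_degree_add[OF T x(1) y(1)] gd_mult[OF T x(1) y(1) x(2) y(2)]
        _ _ rest[unfolded low_def]] N(1) by auto
    then show False using pr[OF hom] x y by auto
  qed
  then show ?thesis using idl ne I unfolding homogeneous_prime_def prime_ideal_of_def by blast
qed

lemma homogeneous_ideal_add_principal: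
  assumes T: "graded_domain T" and I: "homogeneous_ideal T I" and a: "a \<in> homog T"
  shows "homogeneous_ideal T {i + a * t | i t. i \<in> I \<and> t \<in> elements T}" (is "homogeneous_ideal T ?J")
proof -
  note R = gd_subring[OF T]
  have idl: "ideal_of (elements T) I" and hI: "I \<subseteq> sums_of (I \<inter> homog T)"
    using I homogeneous_ideal_iff[OF T] by auto
  have a': "a \<in> elements T" using a homog_elements[OF T] by auto
  have zero: "0 \<in> I" using ideal_ofD(2)[OF idl] .
  have idlJ: "ideal_of (elements T) ?J"
    unfolding ideal_of_def
  proof (intro conjI ballI)
    show "?J \<subseteq> elements T" using ideal_ofD(1)[OF idl] a' by (auto intro!: subring_setD[OF R])
    show "0 \<in> ?J" using zero subring_setD(2)[OF R] by (intro CollectI exI[of _ 0]) auto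
    fix x assume "x \<in> ?J"
    then obtain i t where x: "x = i + a * t" "i \<in> I" "t \<in> elements T" by blast
    { fix y assume "y \<in> ?J"
      then obtain j u where y: "y = j + a * u" "j \<in> I" "u \<in> elements T" by blast
      have "x + y = (i + j) + a * (t + u)" using x y by (simp add: algebra_simps)
      then show "x + y \<in> ?J" using x y ideal_ofD(3)[OF idl] subring_setD(6)[OF R] by blast }
    { fix s assume s: "s \<in> elements T"
      have "s * x = s * i + a * (s * t)" using x by (simp add: algebra_simps)
      then show "s * x \<in> ?J" using x s ideal_ofD(4)[OF idl] subring_setD(4)[OF R] by blast }
  qed
  have IJ: "I \<subseteq> ?J"
  proof
    fix i assume "i \<in> I"
    moreover have "i = i + a * 0" by simp
    ultimately show "i \<in> ?J" using subring_setD(2)[OF R] by blast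
  qed
  have aJ: "a * t \<in> ?J" if "t \<in> elements T" for t using that zero by force
  have "i + a * t \<in> sums_of (?J \<inter> homog T)" if it: "i \<in> I" "t \<in> elements T" for i t
  proof (rule sums_of_add)
    show "i \<in> sums_of (?J \<inter> homog T)"
      using it(1) hI sums_of_mono[of "I \<inter> homog T" "?J \<inter> homog T"] IJ by blast
    show "a * t \<in> sums_of (?J \<inter> homog T)"
      by (rule sums_of_mult_left[OF it(2)[unfolded gd_elements[OF T]]])
        (rule sums_of_incl, rule IntI, rule aJ, use homog_elements[OF T] homog_mult[OF T a] in auto)
  qed
  then show ?thesis using idlJ homogeneous_ideal_iff[OF T] by blast
qed

text \<open>
  The graded form of the classical construction of prime ideals: a homogeneous ideal that is
  maximal among those disjoint from a multiplicative set of homogeneous elements is prime.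
\<close>

lemma exists_homogeneous_prime:
  assumes T: "graded_domain T" and I: "homogeneous_ideal T I"
    and S: "S \<subseteq> homog T" "S \<noteq> {}" "\<And>a b. a \<in> S \<Longrightarrow> b \<in> S \<Longrightarrow> a * b \<in> S" "I \<inter> S = {}"
  obtains Q where "homogeneous_prime T Q" "I \<subseteq> Q" "Q \<inter> S = {}"
proof -
  define \<A> where "\<A> = {J. homogeneous_ideal T J \<and> I \<subseteq> J \<and> J \<inter> S = {}}"
  have "\<exists>Q\<in>\<A>. \<forall>X\<in>\<A>. Q \<subseteq> X \<longrightarrow> X = Q"
  proof (rule subset_Zorn_nonempty)
    show "\<A> \<noteq> {}" using I S(4) unfolding \<A>_def by auto
    fix \<C> assume \<C>: "\<C> \<noteq> {}" and "subset.chain \<A> \<C>"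
    then have ch: "\<And>X. X \<in> \<C> \<Longrightarrow> X \<in> \<A>" "\<And>X Y. X \<in> \<C> \<Longrightarrow> Y \<in> \<C> \<Longrightarrow> X \<subseteq> Y \<or> Y \<subseteq> X"
      unfolding subset_chain_def by auto
    have idl: "ideal_of (elements T) X" "X \<subseteq> sums_of (X \<inter> homog T)" if "X \<in> \<C>" for X
      using ch(1)[OF that] homogeneous_ideal_iff[OF T] unfolding \<A>_def by auto
    have "ideal_of (elements T) (\<Union>\<C>)"
      unfolding ideal_of_def
    proof (intro conjI ballI)
      show "\<Union>\<C> \<subseteq> elements T" using idl ideal_ofD(1) by blast
      show "0 \<in> \<Union>\<C>" using idl ideal_ofD(2) \<C> by blast
      fix x assume x: "x \<in> \<Union>\<C>"
      { fix y assume "y \<in> \<Union>\<C>"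
        then obtain X where X: "X \<in> \<C>" "x \<in> X" "y \<in> X" using x ch(2) by blast
        then show "x + y \<in> \<Union>\<C>" using ideal_ofD(3)[OF idl(1)] by blast }
      { fix s assume "s \<in> elements T"
        then show "s * x \<in> \<Union>\<C>" using x ideal_ofD(4)[OF idl(1)] by blast }
    qed
    moreover have "\<Union>\<C> \<subseteq> sums_of (\<Union>\<C> \<inter> homog T)"
    proof
      fix x assume "x \<in> \<Union>\<C>"
      then obtain X where X: "X \<in> \<C>" "x \<in> X" by blast
      have "X \<inter> homog T \<subseteq> \<Union>\<C> \<inter> homog T" using X by blast
      then show "x \<in> sums_of (\<Union>\<C> \<inter> homog T)" using idl(2)[OF X(1)] X(2) sums_of_mono by blast
    qed
    ultimately have "homogeneous_ideal T (\<Union>\<C>)" using homogeneous_ideal_iff[OF T] by blast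
    moreover have "I \<subseteq> \<Union>\<C>" "\<Union>\<C> \<inter> S = {}" using ch(1) \<C> unfolding \<A>_def by auto
    ultimately show "\<Union>\<C> \<in> \<A>" unfolding \<A>_def by blast
  qed
  then obtain Q where Q: "Q \<in> \<A>" and max: "\<And>X. X \<in> \<A> \<Longrightarrow> Q \<subseteq> X \<Longrightarrow> X = Q" by auto
  then have hQ: "homogeneous_ideal T Q" and IQ: "I \<subseteq> Q" and QS: "Q \<inter> S = {}" unfolding \<A>_def by auto
  note R = gd_subring[OF T]
  have idl: "ideal_of (elements T) Q" using hQ homogeneous_ideal_iff[OF T] by auto
  have meet: "\<exists>i\<in>Q. \<exists>t\<in>elements T. i + a * t \<in> S" if a: "a \<in> homog T" "a \<notin> Q" for a
  proof (rule ccontr)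
    assume none: "\<not> ?thesis"
    let ?J = "{i + a * t | i t. i \<in> Q \<and> t \<in> elements T}"
    have QJ: "Q \<subseteq> ?J"
    proof
      fix i assume "i \<in> Q"
      moreover have "i = i + a * 0" by simp
      ultimately show "i \<in> ?J" using subring_setD(2)[OF R] by blast
    qed
    have "?J \<in> \<A>"
      using homogeneous_ideal_add_principal[OF T hQ a(1)] none IQ QJ unfolding \<A>_def by blast
    then have "?J = Q" using max QJ by blast
    moreover have "0 + a * 1 \<in> ?J" using ideal_ofD(2)[OF idl] subring_setD(1)[OF R] by blast
    ultimately show False using a(2) by simp
  qed
  have "homogeneous_prime T Q"
  proof (rule homogeneous_primeI[OF T hQ])
    show "Q \<noteq> elements T" using QS S(1,2) homog_elements[OF T] by blast
    fix a b assume ab: "a \<in> homog T" "b \<in> homog T" "a * b \<in> Q"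
    show "a \<in> Q \<or> b \<in> Q"
    proof (rule ccontr)
      assume "\<not> ?thesis"
      then obtain i t j u where *: "i \<in> Q" "t \<in> elements T" "i + a * t \<in> S"
        "j \<in> Q" "u \<in> elements T" "j + b * u \<in> S"
        using meet ab by meson
      have el: "a \<in> elements T" "b \<in> elements T" "j \<in> elements T" using ab homog_elements[OF T] * ideal_ofD(1)[OF idl] by auto
      have "(i + a * t) * (j + b * u) = i * (j + b * u) + (a * t) * j + (a * b) * (t * u)"
        by (simp add: algebra_simps)
      also have "\<dots> \<in> Q"
        by (intro ideal_ofD(3,4,5)[OF idl] subring_setD[OF R] * el ab)
      finally show False using S(3)[OF *(3,6)] QS by blast
    qed
  qed
  then show ?thesis using that IQ QS by blast
qed

section \<open>Extensions of graded domains\<close>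

lemma graded_subringD:
  assumes "graded_subring R T"
  shows "graded_domain R" "graded_domain T" "elements R \<subseteq> elements T" "homog R \<subseteq> homog T"
proof -
  show "graded_domain R" "graded_domain T" "elements R \<subseteq> elements T"
    using assms unfolding graded_subring_def by auto
  have "degrees R \<subseteq> degrees T" "\<And>a. a \<in> degrees R \<Longrightarrow> component R a \<subseteq> component T a"
    using assms unfolding graded_subring_def by auto
  then show "homog R \<subseteq> homog T" unfolding homog_def by (rule UN_mono)
qed

text \<open>
  A homogeneous ideal of \<open>T\<close> contracts to a homogeneous ideal of \<open>R\<close>, because a decomposition in \<open>R\<close>
  is also one in \<open>T\<close>.  Hence contractions can be compared on homogeneous elements.
\<close>

lemma homogeneous_ideal_contract:
  assumes RT: "graded_subring R T" and I: "homogeneous_ideal T I" and x: "x \<in> I" "x \<in> elements R"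
  shows "x \<in> sums_of (I \<inter> homog R)"
proof -
  obtain F c where F: "finite F" "F \<subseteq> degrees R" "\<And>g. g \<in> F \<Longrightarrow> c g \<in> component R g" "x = (\<Sum>g\<in>F. c g)"
    using gd_decompose[OF graded_subringD(1)[OF RT] x(2)] by blast
  have "c g \<in> I" if "g \<in> F" for g
  proof (rule homogeneous_ideal_component[OF graded_subringD(2)[OF RT] I F(1)])
    show "F \<subseteq> degrees T" "\<And>h. h \<in> F \<Longrightarrow> c h \<in> component T h"
      using F(2,3) RT unfolding graded_subring_def by blast+
  qed (use F(4) x that in auto)
  then show ?thesis
    unfolding F(4) by (intro sums_of_sum sums_of_incl) (use F in \<open>auto simp: homog_def\<close>)
qed

lemma homogeneous_ideal_contract_subset:
  assumes "graded_subring R T" "homogeneous_ideal T I" "ideal_of (elements R) P"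
    and "I \<inter> homog R \<subseteq> P"
  shows "I \<inter> elements R \<subseteq> P"
  using homogeneous_ideal_contract[OF assms(1,2)] ideal_of_sums_of[OF assms(3,4)] by blast

definition mul_span :: "'a::comm_ring_1 set \<Rightarrow> 'a set \<Rightarrow> 'a set" where
  "mul_span I X = sums_of {i * x | i x. i \<in> I \<and> x \<in> X}"

lemma mul_span_incl: "i \<in> I \<Longrightarrow> x \<in> X \<Longrightarrow> i * x \<in> mul_span I X"
  unfolding mul_span_def by (intro sums_of_incl) auto

lemma mul_span_zero: "0 \<in> mul_span I X"
  and mul_span_add: "x \<in> mul_span I X \<Longrightarrow> y \<in> mul_span I X \<Longrightarrow> x + y \<in> mul_span I X"
  and mul_span_sum: "(\<And>i. i \<in> F \<Longrightarrow> f i \<in> mul_span I X) \<Longrightarrow> (\<Sum>i\<in>F. f i) \<in> mul_span I X"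
  unfolding mul_span_def by (auto intro: sums_of_add sums_of_sum)

lemma mul_span_mono: "I \<subseteq> J \<Longrightarrow> X \<subseteq> Y \<Longrightarrow> mul_span I X \<subseteq> mul_span J Y"
  unfolding mul_span_def by (rule sums_of_mono) blast

lemma mul_span_scale: "(\<And>i. i \<in> I \<Longrightarrow> s * i \<in> J) \<Longrightarrow> x \<in> mul_span I X \<Longrightarrow> s * x \<in> mul_span J X"
  unfolding mul_span_def
proof (erule sums_of_mult_left, clarify)
  fix i x assume "\<And>i. i \<in> I \<Longrightarrow> s * i \<in> J" "i \<in> I" "x \<in> X"
  then show "s * (i * x) \<in> sums_of {i * x |i x. i \<in> J \<and> x \<in> X}"
    by (intro sums_of_incl) (auto simp: mult.assoc[symmetric])
qed

lemma mul_span_ideal: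
  assumes "subring_set A" "I \<subseteq> A" shows "ideal_of A (mul_span I A)"
  unfolding ideal_of_def
proof (intro conjI ballI)
  show "mul_span I A \<subseteq> A" unfolding mul_span_def
    by (rule sums_of_least) (use assms in \<open>auto intro!: subring_setD\<close>)
  fix s x assume s: "s \<in> A" "x \<in> mul_span I A"
  show "s * x \<in> mul_span I A"
    using s(2) unfolding mul_span_def
  proof (rule sums_of_mult_left, clarify)
    fix i x assume "i \<in> I" "x \<in> A"
    then show "s * (i * x) \<in> sums_of {i * x |i x. i \<in> I \<and> x \<in> A}"
      using s(1) subring_setD(4)[OF assms(1), of s x] by (intro sums_of_incl) (auto simp: mult.left_commute)
  qed
qed (auto intro: mul_span_add mul_span_zero)

text \<open>
  The last inclusion is there because equations of integral dependence will be available only for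
  homogeneous numerators.
\<close>

lemma homogeneous_ideal_extend:
  assumes RT: "graded_subring R T" and P: "homogeneous_ideal R P"
  shows "homogeneous_ideal T (mul_span P (elements T))" "P \<subseteq> mul_span P (elements T)"
    "mul_span P (elements T) \<subseteq> mul_span (P \<inter> homog R) (elements T)"
proof -
  note T = graded_subringD(2)[OF RT]
  have P2: "P \<subseteq> elements R" "P \<subseteq> sums_of (P \<inter> homog R)"
    using P homogeneous_ideal_iff[OF graded_subringD(1)[OF RT], of P] ideal_ofD(1)[of _ P] by auto
  have gen: "x * t \<in> sums_of ((mul_span P (elements T)) \<inter> homog T)" if xt: "x \<in> P" "t \<in> elements T" for x t
  proof (rule sums_of_mult)
    show "x \<in> sums_of (P \<inter> homog R)" "t \<in> sums_of (homog T)"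
      using xt P2 gd_elements[OF T] by auto
    fix x y assume "x \<in> P \<inter> homog R" "y \<in> homog T"
    then show "x * y \<in> sums_of (mul_span P (elements T) \<inter> homog T)"
      using homog_mult[OF T, of x y] graded_subringD(4)[OF RT] homog_elements[OF T] mul_span_incl[of x P y "elements T"]
      by (intro sums_of_incl) auto
  qed
  have "mul_span P (elements T) \<subseteq> sums_of (mul_span P (elements T) \<inter> homog T)"
    unfolding mul_span_def[of P "elements T"]
    by (rule sums_of_least, fold mul_span_def[of P "elements T"]) (use gen in \<open>auto intro: sums_of_add\<close>)
  then show "homogeneous_ideal T (mul_span P (elements T))"
    using homogeneous_ideal_iff[OF T] mul_span_ideal[OF gd_subring[OF T]] P2 graded_subringD(3)[OF RT] by blast
  show "P \<subseteq> mul_span P (elements T)"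
    using mul_span_incl[of _ P 1 "elements T"] subring_setD(1)[OF gd_subring[OF T]] by auto
  show "mul_span P (elements T) \<subseteq> mul_span (P \<inter> homog R) (elements T)"
    unfolding mul_span_def[of P]
  proof (rule sums_of_least; clarify?)
    fix x t assume xt: "x \<in> P" "t \<in> elements T"
    have "t * x \<in> mul_span (P \<inter> homog R) (elements T)"
      unfolding mul_span_def
    proof (rule sums_of_mult_left)
      show "x \<in> sums_of (P \<inter> homog R)" using P2 xt by auto
    qed (use xt(2) in \<open>auto intro!: sums_of_incl simp: mult.commute\<close>)
    then show "x * t \<in> mul_span (P \<inter> homog R) (elements T)" by (simp add: mult.commute)
  qed (auto intro: mul_span_add mul_span_zero)
qed

section \<open>Elements integral over a prime ideal\<close>

lemma mul_span_insertE:
  assumes I: "ideal_of A I" and x: "x \<in> mul_span I (insert y X)"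
  obtains q w where "q \<in> I" "w \<in> mul_span I X" "x = q * y + w"
proof -
  have "mul_span I (insert y X) \<subseteq> {q * y + w | q w. q \<in> I \<and> w \<in> mul_span I X}" (is "_ \<subseteq> ?B")
    unfolding mul_span_def[of I "insert y X"]
  proof (rule sums_of_least)
    have zero: "0 \<in> I" using ideal_ofD(2)[OF I] .
    show "{i * x |i x. i \<in> I \<and> x \<in> insert y X} \<subseteq> ?B"
    proof clarify
      fix i x assume i: "i \<in> I" "x \<in> insert y X"
      have "i * x = 0 * y + i * x" "i * x = i * x + 0" by simp_all
      then show "\<exists>q w. i * x = q * y + w \<and> q \<in> I \<and> w \<in> mul_span I X"
        using i zero mul_span_incl[of i I x X] mul_span_zero[of I X] by blast
    qed
    have "0 = 0 * y + 0" by simp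
    then show "0 \<in> ?B" using zero mul_span_zero by blast
    fix a b assume "a \<in> ?B" "b \<in> ?B"
    then obtain q w p v where "a = q * y + w" "q \<in> I" "w \<in> mul_span I X" "b = p * y + v" "p \<in> I" "v \<in> mul_span I X"
      by blast
    moreover from this have "a + b = (q + p) * y + (w + v)" by (simp add: algebra_simps)
    ultimately show "a + b \<in> ?B" using ideal_ofD(3)[OF I] mul_span_add by blast
  qed
  then show ?thesis using that x by blast
qed

lemma mul_span_smult:
  assumes "ideal_of A I" "s \<in> A" "x \<in> mul_span I X"
  shows "s * x \<in> mul_span I X"
  by (rule mul_span_scale[OF _ assms(3)]) (rule ideal_ofD(4)[OF assms(1,2)])

lemma mul_span_ideal_mult:
  assumes "ideal_of A I" "i \<in> I" "x \<in> mul_span A X"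
  shows "i * x \<in> mul_span I X"
  by (rule mul_span_scale[OF _ assms(3)]) (rule ideal_ofD(5)[OF assms(1) _ assms(2)])

text \<open>
  Nakayama's lemma for finitely generated submodules of a domain, localized at a prime \<open>Q\<close>: the
  coefficient \<open>d - q\<close> of a generator \<open>x\<close> in its own equation lies outside \<open>Q\<close>, so that \<open>x\<close> can be
  eliminated.
\<close>

lemma nakayama:
  fixes X :: "'a::idom set"
  assumes A: "subring_set A" and Q: "prime_ideal_of A Q" and "finite X"
    and "\<And>x. x \<in> X \<Longrightarrow> \<exists>d\<in>A - Q. d * x \<in> mul_span Q X"
  shows "X \<subseteq> {0}"
  using assms(3,4)
proof (induction X)
  case (insert x X)
  note I = prime_ideal_ofD(1)[OF Q]
  obtain d where d: "d \<in> A - Q" "d * x \<in> mul_span Q (insert x X)" using insert.prems by blast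
  obtain q w where q: "q \<in> Q" "w \<in> mul_span Q X" "d * x = q * x + w"
    using mul_span_insertE[OF I d(2)] by blast
  define e where "e = d - q"
  have e: "e \<in> A - Q"
  proof -
    have "e \<in> A" using d q ideal_ofD(1)[OF I] subring_setD(3)[OF A] unfolding e_def by auto
    moreover have "e \<notin> Q" using d q ideal_ofD(3)[OF I, of e q] unfolding e_def by auto
    ultimately show ?thesis by simp
  qed
  have ex: "e * x = w" using q(3) unfolding e_def by (simp add: algebra_simps)
  have "\<exists>d\<in>A - Q. d * y \<in> mul_span Q X" if "y \<in> X" for y
  proof -
    obtain c where c: "c \<in> A - Q" "c * y \<in> mul_span Q (insert x X)" using insert.prems \<open>y \<in> X\<close> by blast
    obtain p v where p: "p \<in> Q" "v \<in> mul_span Q X" "c * y = p * x + v"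
      using mul_span_insertE[OF I c(2)] by blast
    have pA: "p \<in> A" using p(1) ideal_ofD(1)[OF I] by auto
    have "(e * c) * y = e * (p * x + v)" using p(3) by (simp add: mult.assoc)
    also have "\<dots> = p * w + e * v" unfolding ex[symmetric] by (simp add: algebra_simps)
    also have "\<dots> \<in> mul_span Q X"
      by (intro mul_span_add mul_span_smult[OF I]) (use pA e q p in auto)
    finally have "(e * c) * y \<in> mul_span Q X" .
    moreover have "e * c \<in> A - Q" using e c prime_ideal_ofD(3)[OF Q] subring_setD(4)[OF A] by blast
    ultimately show ?thesis by blast
  qed
  then have X: "X \<subseteq> {0}" by (rule insert.IH)
  have "mul_span Q X \<subseteq> {0}" unfolding mul_span_def by (rule sums_of_least) (use X in auto)
  then have "e * x = 0" using ex q by auto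
  moreover have "e \<noteq> 0" using e ideal_ofD(2)[OF I] by auto
  ultimately show ?case using X by simp
qed simp

text \<open>
  This is an equation of integral dependence for the fraction \<open>y / r\<close> over the localization of \<open>A\<close>
  at \<open>Q\<close>, with all lower coefficients in the maximal ideal, written without denominators.
\<close>

definition integral_over_prime :: "'a::idom set \<Rightarrow> 'a set \<Rightarrow> 'a \<Rightarrow> 'a \<Rightarrow> bool" where
  "integral_over_prime A Q r y \<longleftrightarrow>
     (\<exists>n a. a 0 \<in> A - Q \<and> (\<forall>i\<in>{1..n}. a i \<in> Q) \<and> (\<Sum>i\<le>n. a i * r ^ i * y ^ (n - i)) = 0)"

locale prime_of_subring =
  fixes A Q :: "'a::idom set"
  assumes subring: "subring_set A" and prime: "prime_ideal_of A Q"
begin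

lemma idl: "ideal_of A Q" using prime_ideal_ofD(1)[OF prime] .

lemma idlA: "ideal_of A A" using subring_setD[OF subring] unfolding ideal_of_def by auto

lemma QA: "Q \<subseteq> A" using ideal_ofD(1)[OF idl] .

lemma unit_mult: "c \<in> A - Q \<Longrightarrow> d \<in> A - Q \<Longrightarrow> c * d \<in> A - Q"
  using prime_ideal_ofD(3)[OF prime] subring_setD(4)[OF subring] by blast

lemma unit_one: "1 \<in> A - Q"
  using prime_ideal_not_one[OF prime] subring_setD(1)[OF subring] by blast

text \<open>
  After localization at \<open>Q\<close>, multiplication by \<open>z / r\<close> maps the module spanned by \<open>X\<close> into its
  multiple by \<open>I\<close>.
\<close>

definition maps_span :: "'a set \<Rightarrow> 'a set \<Rightarrow> 'a \<Rightarrow> 'a \<Rightarrow> bool" where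
  "maps_span I X r z \<longleftrightarrow> (\<forall>x\<in>mul_span A X. \<exists>d\<in>A - Q. \<exists>w\<in>mul_span I X. d * (z * x) = r * w)"

lemma maps_spanI:
  assumes I: "ideal_of A I" and g: "\<And>x. x \<in> X \<Longrightarrow> \<exists>d\<in>A - Q. \<exists>w\<in>mul_span I X. d * (z * x) = r * w"
  shows "maps_span I X r z"
proof -
  let ?B = "{x. \<exists>d\<in>A - Q. \<exists>w\<in>mul_span I X. d * (z * x) = r * w}"
  have "mul_span A X \<subseteq> ?B"
    unfolding mul_span_def[of A]
  proof (rule sums_of_least)
    show "{i * x |i x. i \<in> A \<and> x \<in> X} \<subseteq> ?B"
    proof clarify
      fix a x assume a: "a \<in> A" "x \<in> X"
      obtain d w where d: "d \<in> A - Q" "w \<in> mul_span I X" "d * (z * x) = r * w" using g a by blast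
      have "d * (z * (a * x)) = a * (d * (z * x))" by (simp add: mult_ac)
      also have "\<dots> = r * (a * w)" unfolding d(3) by (simp add: mult_ac)
      finally show "\<exists>d\<in>A - Q. \<exists>w\<in>mul_span I X. d * (z * (a * x)) = r * w"
        using d mul_span_smult[OF I a(1)] by blast
    qed
    show "0 \<in> ?B" using unit_one mul_span_zero[of I X] by auto
    fix x y assume "x \<in> ?B" "y \<in> ?B"
    then obtain d w e v where d: "d \<in> A - Q" "w \<in> mul_span I X" "d * (z * x) = r * w"
      "e \<in> A - Q" "v \<in> mul_span I X" "e * (z * y) = r * v" by blast
    have "(d * e) * (z * (x + y)) = e * (d * (z * x)) + d * (e * (z * y))" by (simp add: algebra_simps)
    also have "\<dots> = r * (e * w + d * v)" unfolding d(3,6) by (simp add: algebra_simps)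
    finally show "x + y \<in> ?B"
      using unit_mult[OF d(1,4)] mul_span_add[OF mul_span_smult[OF I _ d(2)] mul_span_smult[OF I _ d(5)], of e d] d(1,4)
      by blast
  qed
  then show ?thesis unfolding maps_span_def by blast
qed

lemma maps_span_mult:
  assumes "maps_span A X r z" "maps_span I X s y" and I: "ideal_of A I"
  shows "maps_span I X (r * s) (z * y)"
  unfolding maps_span_def
proof
  fix x assume "x \<in> mul_span A X"
  then obtain d w where d: "d \<in> A - Q" "w \<in> mul_span A X" "d * (z * x) = r * w"
    using assms(1) unfolding maps_span_def by blast
  obtain e v where e: "e \<in> A - Q" "v \<in> mul_span I X" "e * (y * w) = s * v"
    using assms(2) d(2) unfolding maps_span_def by blast
  have "(d * e) * (z * y * x) = e * (y * (d * (z * x)))" by (simp add: mult_ac)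
  also have "\<dots> = r * (e * (y * w))" unfolding d(3) by (simp add: mult_ac)
  also have "\<dots> = (r * s) * v" unfolding e(3) by (simp add: mult_ac)
  finally show "\<exists>d\<in>A - Q. \<exists>w\<in>mul_span I X. d * (z * y * x) = r * s * w"
    using unit_mult d e by blast
qed

lemma maps_span_one: "maps_span A X 1 1"
  unfolding maps_span_def using unit_one by fastforce

lemma maps_span_power: "maps_span A X r z \<Longrightarrow> maps_span A X (r ^ n) (z ^ n)"
proof (induction n)
  case (Suc n)
  then show ?case using maps_span_mult[OF Suc.prems Suc.IH idlA] by simp
qed (simp add: maps_span_one)

lemma maps_span_smult:
  assumes "maps_span I X r z" "ideal_of A I" "s \<in> A"
  shows "maps_span I X r (s * z)"
  unfolding maps_span_def
proof
  fix x assume "x \<in> mul_span A X"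
  then obtain d w where d: "d \<in> A - Q" "w \<in> mul_span I X" "d * (z * x) = r * w"
    using assms(1) unfolding maps_span_def by blast
  have "d * (s * z * x) = s * (d * (z * x))" by (simp add: mult_ac)
  also have "\<dots> = r * (s * w)" unfolding d(3) by (simp add: mult_ac)
  finally show "\<exists>d\<in>A - Q. \<exists>w\<in>mul_span I X. d * (s * z * x) = r * w"
    using d mul_span_smult[OF assms(2,3)] by blast
qed

lemma maps_span_add:
  assumes "maps_span I X r y" "maps_span I X r z" and I: "ideal_of A I"
  shows "maps_span I X r (y + z)"
  unfolding maps_span_def
proof
  fix x assume x: "x \<in> mul_span A X"
  obtain d w e v where d: "d \<in> A - Q" "w \<in> mul_span I X" "d * (y * x) = r * w"
    and e: "e \<in> A - Q" "v \<in> mul_span I X" "e * (z * x) = r * v"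
    using x assms(1,2) unfolding maps_span_def by blast
  have "(d * e) * ((y + z) * x) = e * (d * (y * x)) + d * (e * (z * x))" by (simp add: algebra_simps)
  also have "\<dots> = r * (e * w + d * v)" unfolding d(3) e(3) by (simp add: algebra_simps)
  finally show "\<exists>d\<in>A - Q. \<exists>w\<in>mul_span I X. d * ((y + z) * x) = r * w"
    using unit_mult[OF d(1) e(1)] mul_span_add[OF mul_span_smult[OF I _ d(2)] mul_span_smult[OF I _ e(2)], of e d] d(1) e(1)
    by blast
qed

lemma maps_span_zero: "maps_span I X r 0"
  unfolding maps_span_def using unit_one mul_span_zero[of I X] by fastforce

lemma maps_span_sum:
  "(\<And>i. i \<in> F \<Longrightarrow> maps_span I X r (f i)) \<Longrightarrow> ideal_of A I \<Longrightarrow> maps_span I X r (\<Sum>i\<in>F. f i)"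
  by (induction F rule: infinite_finite_induct) (auto intro: maps_span_add maps_span_zero)

lemma maps_span_preserves:
  assumes z: "maps_span A X r z" and I: "ideal_of A I" and v: "v \<in> mul_span I X"
  shows "\<exists>d\<in>A - Q. \<exists>w\<in>mul_span I X. d * (z * v) = r * w"
proof -
  let ?B = "{v. \<exists>d\<in>A - Q. \<exists>w\<in>mul_span I X. d * (z * v) = r * w}"
  have "mul_span I X \<subseteq> ?B"
    unfolding mul_span_def[of I X]
  proof (rule sums_of_least, fold mul_span_def[of I X])
    show "{i * x |i x. i \<in> I \<and> x \<in> X} \<subseteq> ?B"
    proof clarify
      fix i x assume i: "i \<in> I" "x \<in> X"
      have "x \<in> mul_span A X" using mul_span_incl[of 1 A x X] subring_setD(1)[OF subring] i by simp
      then obtain d w where d: "d \<in> A - Q" "w \<in> mul_span A X" "d * (z * x) = r * w"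
        using z unfolding maps_span_def by blast
      have "d * (z * (i * x)) = i * (d * (z * x))" by (simp add: mult_ac)
      also have "\<dots> = r * (i * w)" unfolding d(3) by (simp add: mult_ac)
      finally show "\<exists>d\<in>A - Q. \<exists>w\<in>mul_span I X. d * (z * (i * x)) = r * w"
        using d(1) mul_span_ideal_mult[OF I i(1) d(2)] by blast
    qed
    show "0 \<in> ?B" using unit_one mul_span_zero[of I X] by auto
    fix x y assume "x \<in> ?B" "y \<in> ?B"
    then obtain d w e v where d: "d \<in> A - Q" "w \<in> mul_span I X" "d * (z * x) = r * w"
      "e \<in> A - Q" "v \<in> mul_span I X" "e * (z * y) = r * v" by blast
    have "(d * e) * (z * (x + y)) = e * (d * (z * x)) + d * (e * (z * y))" by (simp add: algebra_simps)
    also have "\<dots> = r * (e * w + d * v)" unfolding d(3,6) by (simp add: algebra_simps)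
    finally show "x + y \<in> ?B"
      using unit_mult[OF d(1,4)] mul_span_add[OF mul_span_smult[OF I _ d(2)] mul_span_smult[OF I _ d(5)], of e d] d(1,4)
      by blast
  qed
  then show ?thesis using v by blast
qed

lemma maps_span_product:
  assumes "maps_span I X r z" and I: "ideal_of A I"
  shows "maps_span I {x * y | x y. x \<in> X \<and> y \<in> Y} r z" (is "maps_span I ?XY r z")
proof (rule maps_spanI[OF I], clarify)
  fix x y assume xy: "x \<in> X" "y \<in> Y"
  have "1 * x \<in> mul_span A X" using mul_span_incl[of 1 A x X] subring_setD(1)[OF subring] xy by blast
  then obtain d w where d: "d \<in> A - Q" "w \<in> mul_span I X" "d * (z * x) = r * w"
    using assms(1) unfolding maps_span_def by fastforce
  have "y * w \<in> mul_span I ?XY"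
    using d(2) unfolding mul_span_def
  proof (rule sums_of_mult_left, clarify)
    fix i x assume "i \<in> I" "x \<in> X"
    then have "i * (x * y) \<in> sums_of {i * x |i x. i \<in> I \<and> x \<in> ?XY}"
      using xy(2) by (intro sums_of_incl) blast
    then show "y * (i * x) \<in> sums_of {i * x |i x. i \<in> I \<and> x \<in> ?XY}" by (simp add: mult_ac)
  qed
  moreover have "d * (z * (x * y)) = r * (y * w)"
    using d(3) by (metis mult.assoc mult.commute)
  ultimately show "\<exists>d\<in>A - Q. \<exists>w\<in>mul_span I ?XY. d * (z * (x * y)) = r * w" using d(1) by blast
qed

lemma maps_span_eventually:
  assumes "maps_span A X r z" "maps_span Q X (r ^ k) (z ^ k)" "k \<le> n"
  shows "maps_span Q X (r ^ n) (z ^ n)"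
proof -
  have "maps_span Q X (r ^ (n - k) * r ^ k) (z ^ (n - k) * z ^ k)"
    using maps_span_mult[OF maps_span_power[OF assms(1)] assms(2) idl] .
  then show ?thesis using assms(3) by (simp flip: power_add)
qed

text \<open>
  The condition below says that \<open>y / r\<close> acts on a finitely generated module, and that a power of it
  acts through the maximal ideal.  It follows from an equation of integral dependence and, unlike
  such equations, is easily seen to be closed under sums: take the product of the two modules and
  a power so large that each term of the binomial expansion contains one of the given powers.
\<close>

definition quasi_nilpotent :: "'a \<Rightarrow> 'a \<Rightarrow> bool" where
  "quasi_nilpotent r y \<longleftrightarrow>
     (\<exists>X k. finite X \<and> \<not> X \<subseteq> {0} \<and> maps_span A X r y \<and> maps_span Q X (r ^ k) (y ^ k))"

lemma quasi_nilpotent_zero: "quasi_nilpotent r 0"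
  unfolding quasi_nilpotent_def
  by (rule exI[of _ "{1}"], rule exI[of _ 1]) (auto intro: maps_span_zero)

lemma quasi_nilpotent_smult:
  assumes "quasi_nilpotent r y" "s \<in> A" shows "quasi_nilpotent r (s * y)"
proof -
  obtain X k where X: "finite X" "\<not> X \<subseteq> {0}" "maps_span A X r y" "maps_span Q X (r ^ k) (y ^ k)"
    using assms(1) unfolding quasi_nilpotent_def by blast
  have "maps_span A X r (s * y)" "maps_span Q X (r ^ k) ((s * y) ^ k)"
    unfolding power_mult_distrib
    by (intro maps_span_smult X idl idlA assms(2) subring_setD(7)[OF subring])+
  then show ?thesis using X unfolding quasi_nilpotent_def by blast
qed

lemma quasi_nilpotent_add:
  assumes "quasi_nilpotent r y" "quasi_nilpotent r z" shows "quasi_nilpotent r (y + z)"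
proof -
  obtain X k where X: "finite X" "\<not> X \<subseteq> {0}" "maps_span A X r y" "maps_span Q X (r ^ k) (y ^ k)"
    using assms(1) unfolding quasi_nilpotent_def by blast
  obtain Y l where Y: "finite Y" "\<not> Y \<subseteq> {0}" "maps_span A Y r z" "maps_span Q Y (r ^ l) (z ^ l)"
    using assms(2) unfolding quasi_nilpotent_def by blast
  let ?N = "{x * y | x y. x \<in> X \<and> y \<in> Y}"
  have N: "?N = {y * x | y x. y \<in> Y \<and> x \<in> X}" by (auto simp: mult.commute) (metis mult.commute)+
  have fin: "finite ?N" using finite_image_set2[of "\<lambda>x. x \<in> X" "\<lambda>y. y \<in> Y"] X(1) Y(1) by auto
  obtain x0 y0 where "x0 \<in> X" "x0 \<noteq> 0" "y0 \<in> Y" "y0 \<noteq> 0" using X(2) Y(2) by blast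
  then have "x0 * y0 \<in> ?N" "x0 * y0 \<noteq> 0" by auto
  then have ne: "\<not> ?N \<subseteq> {0}" by blast
  have y: "maps_span A ?N r y" "maps_span Q ?N (r ^ k) (y ^ k)"
    using maps_span_product X idl idlA by blast+
  have z: "maps_span A ?N r z" "maps_span Q ?N (r ^ l) (z ^ l)"
    unfolding N using maps_span_product Y idl idlA by blast+
  have "maps_span Q ?N (r ^ (k + l)) (\<Sum>i\<le>k + l. of_nat ((k + l) choose i) * (y ^ i * z ^ (k + l - i)))"
  proof (rule maps_span_sum[OF _ idl])
    fix i assume i: "i \<in> {..k + l}"
    have nat: "of_nat m \<in> A" for m by (induction m) (auto intro: subring_setD[OF subring])
    have "maps_span Q ?N (r ^ i * r ^ (k + l - i)) (y ^ i * z ^ (k + l - i))"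
    proof (cases "k \<le> i")
      case True
      have "maps_span Q ?N (r ^ (k + l - i) * r ^ i) (z ^ (k + l - i) * y ^ i)"
        by (rule maps_span_mult[OF maps_span_power[OF z(1)] maps_span_eventually[OF y True] idl])
      then show ?thesis by (simp add: mult.commute)
    next
      case False
      show ?thesis
        by (rule maps_span_mult[OF maps_span_power[OF y(1)] maps_span_eventually[OF z] idl]) (use False in simp)
    qed
    then have "maps_span Q ?N (r ^ (k + l)) (y ^ i * z ^ (k + l - i))"
      using i by (simp flip: power_add)
    then show "maps_span Q ?N (r ^ (k + l)) (of_nat ((k + l) choose i) * (y ^ i * z ^ (k + l - i)))"
      by (rule maps_span_smult[OF _ idl nat])
  qed
  then have "maps_span Q ?N (r ^ (k + l)) ((y + z) ^ (k + l))"
    by (simp add: binomial_ring mult.assoc)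
  moreover have "maps_span A ?N r (y + z)" by (rule maps_span_add[OF y(1) z(1) idlA])
  ultimately show ?thesis using fin ne unfolding quasi_nilpotent_def by blast
qed

text \<open>
  For \<open>n\<close> the degree of the equation, the module is spanned by the monomials of degree \<open>n - 1\<close> in \<open>r\<close>
  and \<open>y\<close>; after division by \<open>r ^ (n - 1)\<close> these are the powers of \<open>y / r\<close> below \<open>n\<close>.
\<close>

lemma integral_imp_quasi_nilpotent:
  assumes r: "r \<noteq> 0" and "integral_over_prime A Q r y"
  shows "quasi_nilpotent r y"
proof -
  obtain n a where a0: "a 0 \<in> A - Q" and a: "\<And>i. i \<in> {1..n} \<Longrightarrow> a i \<in> Q"
    and eq: "(\<Sum>i\<le>n. a i * r ^ i * y ^ (n - i)) = 0"
    using assms(2) unfolding integral_over_prime_def by blast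
  obtain m where m: "n = Suc m"
    using eq a0 ideal_ofD(2)[OF idl] by (cases n) auto
  define X where "X = (\<lambda>i. r ^ i * y ^ (m - i)) ` {..m}"
  have fin: "finite X" unfolding X_def by simp
  have "r ^ m \<in> X" unfolding X_def by (rule image_eqI[of _ _ m]) auto
  then have ne: "\<not> X \<subseteq> {0}" using r by auto
  have spanX: "x \<in> X \<Longrightarrow> x \<in> mul_span A X" for x
    using mul_span_incl[of 1 A x X] subring_setD(1)[OF subring] by simp
  \<comment> \<open>The equation rewrites the top power \<open>y ^ n\<close> modulo \<open>r Q\<close> times the module.\<close>
  define w where "w = - (\<Sum>i\<le>m. a (Suc i) * (r ^ i * y ^ (m - i)))"
  have top: "a 0 * y ^ n = r * w"
  proof -
    have "0 = a 0 * y ^ n + (\<Sum>i\<le>m. a (Suc i) * r ^ (Suc i) * y ^ (m - i))"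
      using eq unfolding m by (subst (asm) sum.atMost_Suc_shift) simp
    then show ?thesis unfolding w_def by (simp add: eq_neg_iff_add_eq_0 sum_distrib_left mult_ac)
  qed
  have w: "w \<in> mul_span Q X"
  proof -
    have "(\<Sum>i\<le>m. a (Suc i) * (r ^ i * y ^ (m - i))) \<in> mul_span Q X"
      by (intro mul_span_sum mul_span_incl) (use a m in \<open>auto simp: X_def\<close>)
    then have "(- 1) * (\<Sum>i\<le>m. a (Suc i) * (r ^ i * y ^ (m - i))) \<in> mul_span Q X"
      by (rule mul_span_smult[OF idl, rotated]) (intro subring_setD[OF subring])
    then show ?thesis unfolding w_def by simp
  qed
  have y: "maps_span A X r y"
  proof (rule maps_spanI[OF idlA])
    fix x assume "x \<in> X"
    then obtain i where i: "i \<le> m" "x = r ^ i * y ^ (m - i)" unfolding X_def by auto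
    show "\<exists>d\<in>A - Q. \<exists>w\<in>mul_span A X. d * (y * x) = r * w"
    proof (cases i)
      case 0
      then have "a 0 * (y * x) = r * w" using top i m by (simp flip: power_Suc)
      then show ?thesis using a0 w mul_span_mono[OF QA order_refl] by blast
    next
      case (Suc j)
      then have "1 * (y * x) = r * (r ^ j * y ^ (m - j))"
        using i by (subgoal_tac "m - j = Suc (m - Suc j)") (simp_all add: mult_ac)
      moreover have "r ^ j * y ^ (m - j) \<in> mul_span A X" using i Suc by (intro spanX) (auto simp: X_def)
      ultimately show ?thesis using unit_one by blast
    qed
  qed
  have "maps_span Q X (r ^ n) (y ^ n)"
  proof (rule maps_spanI[OF idl])
    fix x assume x: "x \<in> X"
    \<comment> \<open>For \<open>x = r ^ i * y ^ (m - i)\<close> the first \<open>i\<close> factors \<open>y\<close> lead to \<open>r ^ i * y ^ m\<close>, the next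
      one meets the equation, and the remaining ones preserve the multiple of the module by \<open>Q\<close>.\<close>
    obtain i where i: "i \<le> m" "x = r ^ i * y ^ (m - i)" using x unfolding X_def by auto
    obtain d v where d: "d \<in> A - Q" "v \<in> mul_span Q X" "d * (y ^ (m - i) * w) = r ^ (m - i) * v"
      using maps_span_preserves[OF maps_span_power[OF y] idl w] by blast
    have "d * a 0 * (y ^ n * x) = d * (y ^ (m - i) * (a 0 * y ^ n)) * r ^ i" using i by (simp add: mult_ac)
    also have "\<dots> = d * (y ^ (m - i) * w) * r * r ^ i" unfolding top by (simp add: mult_ac)
    also have "\<dots> = r ^ (m - i) * r ^ i * r * v" unfolding d(3) by (simp add: mult_ac)
    also have "\<dots> = r ^ n * v" using i m by (simp add: mult_ac flip: power_add)
    finally show "\<exists>d\<in>A - Q. \<exists>w\<in>mul_span Q X. d * (y ^ n * x) = r ^ n * w"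
      using unit_mult[OF d(1) a0] d(2) by blast
  qed
  then show ?thesis using fin ne y unfolding quasi_nilpotent_def by blast
qed

lemma quasi_nilpotent_multiple_in_prime:
  assumes r: "r \<noteq> 0" and s: "s \<in> A" and "quasi_nilpotent r (r * s)"
  shows "s \<in> Q"
proof (rule ccontr)
  assume "s \<notin> Q"
  obtain X k where X: "finite X" "\<not> X \<subseteq> {0}" "maps_span Q X (r ^ k) ((r * s) ^ k)"
    using assms(3) unfolding quasi_nilpotent_def by blast
  have sk: "s ^ k \<in> A - Q" using prime_ideal_power[OF subring prime s] \<open>s \<notin> Q\<close> subring_setD(7)[OF subring s] by blast
  have "X \<subseteq> {0}"
  proof (rule nakayama[OF subring prime X(1)])
    fix x assume "x \<in> X"
    then have "x \<in> mul_span A X" using mul_span_incl[of 1 A x X] subring_setD(1)[OF subring] by simp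
    then obtain d w where d: "d \<in> A - Q" "w \<in> mul_span Q X" "d * ((r * s) ^ k * x) = r ^ k * w"
      using X(3) unfolding maps_span_def by blast
    then have "r ^ k * ((d * s ^ k) * x) = r ^ k * w" by (simp add: power_mult_distrib mult_ac)
    then have "(d * s ^ k) * x = w" using r by simp
    then show "\<exists>d\<in>A - Q. d * x \<in> mul_span Q X" using unit_mult[OF d(1) sk] d(2) by blast
  qed
  then show False using X(2) by simp
qed

text \<open>
  In the quotient field: if all \<open>y / r\<close> with \<open>y\<close> in \<open>Y\<close> are integral over \<open>Q\<close> locally, then so is every
  \<open>A\<close>-linear combination \<open>s\<close> of them, and if such an \<open>s\<close> belongs to \<open>A\<close> then it belongs to \<open>Q\<close>.
\<close>

lemma integral_combination_in_prime:
  assumes "r \<noteq> 0" "s \<in> A" "r * s \<in> mul_span Y A" "\<And>y. y \<in> Y \<Longrightarrow> integral_over_prime A Q r y"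
  shows "s \<in> Q"
proof -
  have "mul_span Y A \<subseteq> Collect (quasi_nilpotent r)"
    unfolding mul_span_def
  proof (rule sums_of_least; clarify?)
    fix y a assume "y \<in> Y" "a \<in> A"
    then have "quasi_nilpotent r (a * y)"
      by (intro quasi_nilpotent_smult integral_imp_quasi_nilpotent assms(1,4))
    then show "quasi_nilpotent r (y * a)" by (simp add: mult.commute)
  qed (auto intro: quasi_nilpotent_zero quasi_nilpotent_add)
  then show ?thesis using quasi_nilpotent_multiple_in_prime assms(1-3) by blast
qed

end

section \<open>Going down from integral dependence\<close>

text \<open>
  The intrinsic form of the gGD property, on which all implications turn.  It does not refer to any
  extension of \<open>R\<close>.
\<close>

definition going_down_integral :: "('g::ab_group_add, 'a::idom) graded_ring \<Rightarrow> bool" where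
  "going_down_integral R \<longleftrightarrow>
     (\<forall>P\<^sub>0 P. homogeneous_prime R P\<^sub>0 \<and> homogeneous_prime R P \<and> P\<^sub>0 \<subseteq> P \<longrightarrow>
        (\<forall>p\<in>P\<^sub>0 \<inter> homog R. \<forall>r\<in>homog R - P\<^sub>0. integral_over_prime (elements R) P r p))"

text \<open>
  A prime \<open>Q\<^sub>0\<close> of \<open>T\<close> inside \<open>Q\<close> and over \<open>P\<^sub>0\<close> exists unless the extension of \<open>P\<^sub>0\<close> contains some \<open>r s\<close>
  with homogeneous \<open>r \<notin> P\<^sub>0\<close> and \<open>s \<notin> Q\<close>.  But then \<open>s\<close> is a \<open>T\<close>-linear combination of fractions \<open>p / r\<close>
  with \<open>p\<close> in \<open>P\<^sub>0\<close>, which are integral over \<open>P\<close> locally, and this forces \<open>s \<in> Q\<close>.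
\<close>

lemma going_down_integral_imp_gGD:
  assumes gdi: "going_down_integral R" and RT: "graded_subring R T"
  shows "gGD R T"
  unfolding gGD_def
proof (intro allI impI, elim conjE)
  fix P\<^sub>0 P Q
  assume P0: "homogeneous_prime R P\<^sub>0" and P: "homogeneous_prime R P" and P0P: "P\<^sub>0 \<subseteq> P"
    and Q: "homogeneous_prime T Q" and QP: "Q \<inter> elements R = P"
  note gR = graded_subringD(1)[OF RT] and gT = graded_subringD(2)[OF RT]
  note p0 = homogeneous_primeD[OF gR P0] and q = homogeneous_primeD[OF gT Q]
  interpret prime_of_subring "elements T" Q
    by unfold_locales (use gd_subring[OF gT] q(2) in auto)
  obtain r0 where r0: "r0 \<in> homog R" "r0 \<notin> P\<^sub>0" using homog_outside_prime[OF gR P0] by blast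
  obtain s0 where s0: "s0 \<in> homog T" "s0 \<notin> Q" using homog_outside_prime[OF gT Q] by blast
  let ?I = "mul_span P\<^sub>0 (elements T)"
  let ?S = "{r * s | r s. r \<in> homog R - P\<^sub>0 \<and> s \<in> homog T - Q}"
  note hR = homog_elements[OF gR] and hT = homog_elements[OF gT]
  have rP0: "a * b \<in> homog R - P\<^sub>0" if "a \<in> homog R - P\<^sub>0" "b \<in> homog R - P\<^sub>0" for a b
    using that homog_mult[OF gR, of a b] prime_ideal_ofD(3)[OF p0(2), of a b] hR by auto
  have sQ: "a * b \<in> homog T - Q" if "a \<in> homog T - Q" "b \<in> homog T - Q" for a b
    using that homog_mult[OF gT, of a b] prime_ideal_ofD(3)[OF q(2), of a b] hT by auto
  have disj: "?I \<inter> ?S = {}"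
  proof (rule ccontr)
    assume "?I \<inter> ?S \<noteq> {}"
    then obtain r s where rs: "r \<in> homog R - P\<^sub>0" "s \<in> homog T - Q" "r * s \<in> ?I" by blast
    have "s \<in> Q"
    proof (rule integral_combination_in_prime)
      show "r \<noteq> 0" using rs ideal_ofD(2)[OF p0(3)] by auto
      show "s \<in> elements T" using rs hT by auto
      show "r * s \<in> mul_span (P\<^sub>0 \<inter> homog R) (elements T)"
        using rs homogeneous_ideal_extend(3)[OF RT p0(1)] by blast
      fix y assume "y \<in> P\<^sub>0 \<inter> homog R"
      then have "integral_over_prime (elements R) P r y"
        using gdi P0 P P0P rs(1) unfolding going_down_integral_def by blast
      moreover have "elements R - P \<subseteq> elements T - Q" "P \<subseteq> Q"
        using QP graded_subringD(3)[OF RT] by auto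
      ultimately show "integral_over_prime (elements T) Q r y"
        unfolding integral_over_prime_def by blast
    qed
    then show False using rs by simp
  qed
  obtain Q\<^sub>0 where Q0: "homogeneous_prime T Q\<^sub>0" "?I \<subseteq> Q\<^sub>0" "Q\<^sub>0 \<inter> ?S = {}"
  proof (rule exists_homogeneous_prime[OF gT homogeneous_ideal_extend(1)[OF RT p0(1)] _ _ _ disj])
    show "?S \<subseteq> homog T" using graded_subringD(4)[OF RT] homog_mult[OF gT] by blast
    show "?S \<noteq> {}" using r0 s0 by blast
    fix a b assume "a \<in> ?S" "b \<in> ?S"
    then obtain r s r' s' where "a = r * s" "b = r' * s'" "r \<in> homog R - P\<^sub>0" "s \<in> homog T - Q"
      "r' \<in> homog R - P\<^sub>0" "s' \<in> homog T - Q" by blast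
    moreover from this have "a * b = (r * r') * (s * s')" by (simp add: mult_ac)
    ultimately show "a * b \<in> ?S" using rP0 sQ by blast
  qed blast
  note q0 = homogeneous_primeD[OF gT Q0(1)]
  have "Q\<^sub>0 \<inter> homog T \<subseteq> Q"
  proof
    fix s assume s: "s \<in> Q\<^sub>0 \<inter> homog T"
    have "r0 * s \<in> Q\<^sub>0" by (rule ideal_ofD(4)[OF q0(3)]) (use r0 hR graded_subringD(3)[OF RT] s in auto)
    then show "s \<in> Q" using Q0(3) r0 s by blast
  qed
  then have sub: "Q\<^sub>0 \<subseteq> Q" by (rule homogeneous_prime_subset[OF gT q0(1) _ q(3)])
  have "Q\<^sub>0 \<inter> homog R \<subseteq> P\<^sub>0"
  proof
    fix r assume r: "r \<in> Q\<^sub>0 \<inter> homog R"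
    have "r * s0 \<in> Q\<^sub>0" by (rule ideal_ofD(5)[OF q0(3)]) (use s0 hT r in auto)
    then show "r \<in> P\<^sub>0" using Q0(3) r s0 by blast
  qed
  then have "Q\<^sub>0 \<inter> elements R \<subseteq> P\<^sub>0" by (rule homogeneous_ideal_contract_subset[OF RT q0(1) p0(3)])
  moreover have "P\<^sub>0 \<subseteq> Q\<^sub>0 \<inter> elements R" using Q0(2) homogeneous_ideal_extend(2)[OF RT p0(1)] p0(5) by blast
  ultimately show "\<exists>Q\<^sub>0. homogeneous_prime T Q\<^sub>0 \<and> Q\<^sub>0 \<subseteq> Q \<and> Q\<^sub>0 \<inter> elements R = P\<^sub>0"
    using Q0(1) sub by blast
qed

section \<open>Adjoining an element\<close>

lemma adjoin_monom: "subring_set A \<Longrightarrow> c \<in> A \<Longrightarrow> c * u ^ i \<in> adjoin A u"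
  unfolding adjoin_def
  by (rule CollectI, rule exI[of _ "monom c i"]) (auto simp: poly_monom subring_setD)

lemma adjoin_incl: "subring_set A \<Longrightarrow> A \<subseteq> adjoin A u"
  using adjoin_monom[of A _ u 0] by auto

lemma adjoin_generator: "subring_set A \<Longrightarrow> u \<in> adjoin A u"
  using adjoin_monom[of A 1 u 1] subring_setD(1)[of A] by auto

lemma subring_adjoin:
  assumes A: "subring_set A" shows "subring_set (adjoin A u)"
  unfolding subring_set_def
proof (intro conjI ballI)
  show "1 \<in> adjoin A u" using adjoin_incl[OF A] subring_setD(1)[OF A] by blast
  fix x y assume "x \<in> adjoin A u" "y \<in> adjoin A u"
  then obtain p q where pq: "x = poly p u" "y = poly q u" "\<And>i. coeff p i \<in> A" "\<And>i. coeff q i \<in> A"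
    unfolding adjoin_def by blast
  have "coeff (p - q) i \<in> A" "coeff (p * q) i \<in> A" for i
    using pq(3,4) by (auto simp: coeff_mult intro!: subring_setD[OF A] subring_set_sum[OF A])
  moreover have "x - y = poly (p - q) u" "x * y = poly (p * q) u" using pq(1,2) by simp_all
  ultimately show "x - y \<in> adjoin A u" "x * y \<in> adjoin A u" unfolding adjoin_def by blast+
qed

lemma mul_span_adjoinE:
  assumes "z \<in> mul_span P (adjoin A u)"
  obtains f where "\<And>i. coeff f i \<in> mul_span P A" "z = poly f u"
proof -
  have "mul_span P (adjoin A u) \<subseteq> {poly f u | f. \<forall>i. coeff f i \<in> mul_span P A}" (is "_ \<subseteq> ?B")
    unfolding mul_span_def[of P "adjoin A u"]
  proof (rule sums_of_least)
    show "{i * x |i x. i \<in> P \<and> x \<in> adjoin A u} \<subseteq> ?B"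
    proof clarify
      fix p x assume p: "p \<in> P" and "x \<in> adjoin A u"
      then obtain g where g: "x = poly g u" "\<And>i. coeff g i \<in> A" unfolding adjoin_def by blast
      show "\<exists>f. p * x = poly f u \<and> (\<forall>i. coeff f i \<in> mul_span P A)"
        by (rule exI[of _ "smult p g"]) (use p g in \<open>auto intro: mul_span_incl\<close>)
    qed
    show "0 \<in> ?B" by (rule CollectI, rule exI[of _ 0]) (simp add: mul_span_zero)
    fix x y assume "x \<in> ?B" "y \<in> ?B"
    then obtain f g where fg: "x = poly f u" "y = poly g u" "\<And>i. coeff f i \<in> mul_span P A" "\<And>i. coeff g i \<in> mul_span P A"
      by blast
    show "x + y \<in> ?B"
      by (rule CollectI, rule exI[of _ "f + g"]) (simp add: fg mul_span_add)
  qed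
  then show ?thesis using assms that by blast
qed

section \<open>Homogeneous overrings\<close>

lemma quotient_groupI: "a \<in> M \<Longrightarrow> b \<in> M \<Longrightarrow> a - b \<in> quotient_group M"
  unfolding quotient_group_def by blast

context
  fixes M :: "'g::ab_group_add set"
  assumes M: "torsionless_monoid M"
begin

lemma monoid_zero: "0 \<in> M" and monoid_add: "a \<in> M \<Longrightarrow> b \<in> M \<Longrightarrow> a + b \<in> M"
  using M unfolding torsionless_monoid_def by auto

lemma quotient_group_incl: "M \<subseteq> quotient_group M"
  using quotient_groupI[OF _ monoid_zero] by force

lemma quotient_group_add:
  assumes "g \<in> quotient_group M" "h \<in> quotient_group M" shows "g + h \<in> quotient_group M"
proof -
  obtain a b c d where "g = a - b" "h = c - d" "a \<in> M" "b \<in> M" "c \<in> M" "d \<in> M"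
    using assms unfolding quotient_group_def by blast
  moreover from this have "g + h = (a + c) - (b + d)" by simp
  ultimately show ?thesis using quotient_groupI monoid_add by metis
qed

lemma quotient_group_uminus: "g \<in> quotient_group M \<Longrightarrow> - g \<in> quotient_group M"
  unfolding quotient_group_def by force

lemma torsionless_quotient_group: "torsionless_monoid (quotient_group M)"
  unfolding torsionless_monoid_def
proof (intro conjI ballI allI impI)
  show "0 \<in> quotient_group M" using quotient_group_incl monoid_zero by blast
  fix g h assume gh: "g \<in> quotient_group M" "h \<in> quotient_group M"
  then show "g + h \<in> quotient_group M" by (rule quotient_group_add)
  fix n :: nat assume n: "n > 0" "(\<Sum>i<n. g) = (\<Sum>i<n. h)"
  obtain a b c d where eq: "g = a - b" "h = c - d" and el: "a \<in> M" "b \<in> M" "c \<in> M" "d \<in> M"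
    using gh unfolding quotient_group_def by blast
  have "(\<Sum>i<n. a + d) = (\<Sum>i<n. c + b)"
    using n(2) unfolding eq by (simp add: sum_subtractf sum.distrib algebra_simps)
  moreover have "\<forall>a\<in>M. \<forall>b\<in>M. \<forall>n>0. (\<Sum>i<(n::nat). a) = (\<Sum>i<n. b) \<longrightarrow> a = b"
    using M unfolding torsionless_monoid_def by argo
  ultimately have "a + d = c + b" using n(1) monoid_add el by blast
  then show "g = h" unfolding eq by (simp add: algebra_simps)
qed

end

context
  fixes R :: "('g::ab_group_add, 'a::field) graded_ring"
  assumes R: "graded_domain R"
begin

lemmas torsionless_degrees = gd_monoid(1)[OF R]

lemma hqf_component_zero: "0 \<in> hqf_component R g"
  unfolding hqf_component_def by simp

lemma hqf_componentI:
  "x \<in> component R a \<Longrightarrow> y \<in> component R b \<Longrightarrow> a \<in> degrees R \<Longrightarrow> b \<in> degrees R \<Longrightarrow> x / y \<in> hqf_component R (a - b)"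
  unfolding hqf_component_def by (cases "y = 0") auto

lemma hqf_componentE:
  assumes "z \<in> hqf_component R g" "z \<noteq> 0"
  obtains x y a b where "a \<in> degrees R" "b \<in> degrees R" "g = a - b" "x \<in> component R a"
    "y \<in> component R b" "y \<noteq> 0" "x \<noteq> 0" "z = x / y"
  using assms unfolding hqf_component_def by auto

lemma nonzero_homog:
  obtains b y where "b \<in> degrees R" "y \<in> component R b" "y \<noteq> 0"
proof (atomize_elim, rule ccontr)
  assume "\<nexists>b y. b \<in> degrees R \<and> y \<in> component R b \<and> y \<noteq> 0"
  then have "homog R \<subseteq> {0}" unfolding homog_def by auto
  then have "elements R \<subseteq> {0}" unfolding gd_elements[OF R] by (intro sums_of_least) auto
  then show False using subring_setD(1)[OF gd_subring[OF R]] by auto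
qed

lemma component_hqf_component: "a \<in> degrees R \<Longrightarrow> x \<in> component R a \<Longrightarrow> x \<in> hqf_component R a"
proof -
  assume x: "a \<in> degrees R" "x \<in> component R a"
  obtain b y where y: "b \<in> degrees R" "y \<in> component R b" "y \<noteq> 0" by (rule nonzero_homog)
  have "(x * y) / y \<in> hqf_component R (a + b - b)"
    by (rule hqf_componentI[OF gd_mult[OF R x(1) y(1) x(2) y(2)] y(2) gd_degree_add[OF R x(1) y(1)] y(1)])
  then show ?thesis using y by simp
qed

lemma hqf_component_one: "1 \<in> hqf_component R 0"
proof -
  obtain b y where y: "b \<in> degrees R" "y \<in> component R b" "y \<noteq> 0" by (rule nonzero_homog)
  then show ?thesis using hqf_componentI[OF y(2,2,1,1)] by simp
qed

lemma hqf_component_mult: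
  assumes "x \<in> hqf_component R g" "y \<in> hqf_component R h"
  shows "x * y \<in> hqf_component R (g + h)"
proof (cases "x = 0 \<or> y = 0")
  case True then show ?thesis using hqf_component_zero by auto
next
  case False
  obtain x1 x2 a b where x: "a \<in> degrees R" "b \<in> degrees R" "g = a - b" "x1 \<in> component R a"
    "x2 \<in> component R b" "x = x1 / x2" by (rule hqf_componentE[OF assms(1)]) (use False in blast)+
  obtain y1 y2 c d where y: "c \<in> degrees R" "d \<in> degrees R" "h = c - d" "y1 \<in> component R c"
    "y2 \<in> component R d" "y = y1 / y2" by (rule hqf_componentE[OF assms(2)]) (use False in blast)+
  have "(x1 * y1) / (x2 * y2) \<in> hqf_component R ((a + c) - (b + d))"
    by (intro hqf_componentI gd_mult[OF R] gd_degree_add[OF R] x y)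
  moreover have "(a + c) - (b + d) = g + h" using x y by simp
  ultimately show ?thesis using x y by simp
qed

lemma hqf_component_diff:
  assumes "x \<in> hqf_component R g" "y \<in> hqf_component R g"
  shows "x - y \<in> hqf_component R g"
proof -
  have minus: "- y \<in> hqf_component R g" if yg: "y \<in> hqf_component R g" for y
  proof (cases "y = 0")
    case False
    obtain x1 x2 a b where x: "a \<in> degrees R" "b \<in> degrees R" "g = a - b" "x1 \<in> component R a"
      "x2 \<in> component R b" "y = x1 / x2" by (rule hqf_componentE[OF yg False]) (use False in blast)+
    have "(- x1) / x2 \<in> hqf_component R (a - b)" by (intro hqf_componentI gd_uminus[OF R] x)
    then show ?thesis using x by simp
  qed (simp add: hqf_component_zero)
  show ?thesis
  proof (cases "x = 0 \<or> y = 0")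
    case True then show ?thesis using minus[OF assms(2)] assms(1) by (cases "y = 0") simp_all
  next
    case False
    obtain x1 x2 a b where x: "a \<in> degrees R" "b \<in> degrees R" "g = a - b" "x1 \<in> component R a"
      "x2 \<in> component R b" "x2 \<noteq> 0" "x = x1 / x2" by (rule hqf_componentE[OF assms(1)]) (use False in blast)+
    obtain y1 y2 c d where y: "c \<in> degrees R" "d \<in> degrees R" "g = c - d" "y1 \<in> component R c"
      "y2 \<in> component R d" "y2 \<noteq> 0" "y = y1 / y2" by (rule hqf_componentE[OF assms(2)]) (use False in blast)+
    have deg: "c + b = a + d" using x(3) y(3) by (simp add: algebra_simps)
    have "y1 * x2 \<in> component R (a + d)" using gd_mult[OF R y(1) x(2) y(4) x(5)] deg by simp
    then have "x1 * y2 - y1 * x2 \<in> component R (a + d)"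
      by (rule gd_diff[OF R gd_degree_add[OF R x(1) y(2)] gd_mult[OF R x(1) y(2) x(4) y(5)]])
    then have "(x1 * y2 - y1 * x2) / (x2 * y2) \<in> hqf_component R ((a + d) - (b + d))"
      by (intro hqf_componentI gd_mult[OF R] gd_degree_add[OF R] x y)
    moreover have "x - y = (x1 * y2 - y1 * x2) / (x2 * y2)" using x y by (simp add: field_simps)
    ultimately show ?thesis using x(3) by simp
  qed
qed

lemma hqf_component_inverse:
  assumes "x \<in> hqf_component R g" shows "1 / x \<in> hqf_component R (- g)"
proof (cases "x = 0")
  case False
  obtain x1 x2 a b where x: "a \<in> degrees R" "b \<in> degrees R" "g = a - b" "x1 \<in> component R a"
      "x2 \<in> component R b" "x = x1 / x2" by (rule hqf_componentE[OF assms False]) (use False in blast)+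
  then show ?thesis using hqf_componentI[OF x(5,4,2,1)] by simp
qed (simp add: hqf_component_zero)

lemma hqf_homogeneous_mult: "x \<in> hqf_homogeneous R \<Longrightarrow> y \<in> hqf_homogeneous R \<Longrightarrow> x * y \<in> hqf_homogeneous R"
  unfolding hqf_homogeneous_def
  by clarify (rule UN_I, erule (1) quotient_group_add[OF torsionless_degrees], erule (1) hqf_component_mult)

lemma hqf_homogeneous_inverse: "x \<in> hqf_homogeneous R \<Longrightarrow> 1 / x \<in> hqf_homogeneous R"
  unfolding hqf_homogeneous_def
  by clarify (rule UN_I, erule quotient_group_uminus[OF torsionless_degrees], erule hqf_component_inverse)

lemma hqf_homogeneous_one: "1 \<in> hqf_homogeneous R"
  unfolding hqf_homogeneous_def
  using hqf_component_one quotient_group_incl[OF torsionless_degrees] monoid_zero[OF torsionless_degrees] by blast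

lemma hqf_homogeneous_power: "x \<in> hqf_homogeneous R \<Longrightarrow> x ^ n \<in> hqf_homogeneous R"
  by (induction n) (auto intro: hqf_homogeneous_one hqf_homogeneous_mult)

lemma homog_hqf_homogeneous: "homog R \<subseteq> hqf_homogeneous R"
  unfolding homog_def hqf_homogeneous_def
  using component_hqf_component quotient_group_incl[OF torsionless_degrees] by blast

lemma hqf_homogeneous_divide:
  "x \<in> hqf_homogeneous R \<Longrightarrow> y \<in> hqf_homogeneous R \<Longrightarrow> x / y \<in> hqf_homogeneous R"
  using hqf_homogeneous_mult[OF _ hqf_homogeneous_inverse, of x y] by simp

text \<open>
  A common denominator reduces the independence of the components of the quotient field to that of
  the components of \<open>R\<close>.  The fractions have to be nonzero: a degree that is not realized by any
  nonzero fraction need not be moved into the degrees of \<open>R\<close> by the degree of a nonzero element.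
\<close>

lemma common_denominator:
  assumes "finite F" "\<And>g. g \<in> F \<Longrightarrow> x g \<in> hqf_component R g \<and> x g \<noteq> 0"
  shows "\<exists>b\<in>degrees R. \<exists>y\<in>component R b. y \<noteq> 0 \<and> (\<forall>g\<in>F. g + b \<in> degrees R \<and> x g * y \<in> component R (g + b))"
  using assms
proof (induction F)
  case empty
  obtain b y where "b \<in> degrees R" "y \<in> component R b" "y \<noteq> 0" by (rule nonzero_homog)
  then show ?case by (intro bexI[of _ b] bexI[of _ y]) auto
next
  case (insert h F)
  obtain b y where y: "b \<in> degrees R" "y \<in> component R b" "y \<noteq> 0"
    "\<And>g. g \<in> F \<Longrightarrow> g + b \<in> degrees R \<and> x g * y \<in> component R (g + b)"
    using insert.IH insert.prems by auto
  have "x h \<in> hqf_component R h" "x h \<noteq> 0" using insert.prems by auto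
  then obtain z w c d where z: "c \<in> degrees R" "d \<in> degrees R" "h = c - d" "z \<in> component R c"
    "w \<in> component R d" "w \<noteq> 0" "x h = z / w" by (rule hqf_componentE) blast
  have "g + (b + d) \<in> degrees R \<and> x g * (y * w) \<in> component R (g + (b + d))" if "g \<in> insert h F" for g
  proof (cases "g = h")
    case True
    have "h + (b + d) = c + b" using z(3) by (simp add: algebra_simps)
    moreover have "x h * (y * w) = z * y" unfolding z(7) using z(6) by simp
    ultimately show ?thesis
      unfolding True using gd_mult[OF R z(1) y(1) z(4) y(2)] gd_degree_add[OF R z(1) y(1)] by argo
  next
    case False
    then have g: "g + b \<in> degrees R" "x g * y \<in> component R (g + b)" using y(4) that by auto
    show ?thesis using gd_mult[OF R g(1) z(2) g(2) z(5)] gd_degree_add[OF R g(1) z(2)] by (simp add: add.assoc mult.assoc)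
  qed
  moreover have "b + d \<in> degrees R" "y * w \<in> component R (b + d)" "y * w \<noteq> 0"
    using gd_mult[OF R y(1) z(2) y(2) z(5)] gd_degree_add[OF R y(1) z(2)] y z by auto
  ultimately show ?case by blast
qed

lemma hqf_component_indep:
  assumes F: "finite F" "\<And>g. g \<in> F \<Longrightarrow> x g \<in> hqf_component R g" "(\<Sum>g\<in>F. x g) = 0" and g: "g \<in> F"
  shows "x g = 0"
proof (rule ccontr)
  assume gx: "x g \<noteq> 0"
  let ?F = "{g\<in>F. x g \<noteq> 0}"
  have "\<exists>b\<in>degrees R. \<exists>y\<in>component R b. y \<noteq> 0
      \<and> (\<forall>g\<in>?F. g + b \<in> degrees R \<and> x g * y \<in> component R (g + b))"
    by (rule common_denominator) (use F in simp_all)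
  then obtain b y where y: "y \<noteq> 0" "\<And>g. g \<in> ?F \<Longrightarrow> g + b \<in> degrees R \<and> x g * y \<in> component R (g + b)"
    by blast
  have "(\<Sum>g\<in>?F. x g) = (\<Sum>g\<in>F. x g)" using F(1) by (intro sum.mono_neutral_left) auto
  then have "(\<Sum>g\<in>?F. x g * y) = 0" using F(3) by (simp flip: sum_distrib_right)
  moreover have "(\<Sum>h\<in>(\<lambda>g. g + b) ` ?F. x (h - b) * y) = (\<Sum>g\<in>?F. x g * y)"
    by (subst sum.reindex) (auto simp: inj_on_def)
  ultimately have "(\<Sum>h\<in>(\<lambda>g. g + b) ` ?F. x (h - b) * y) = 0" by simp
  then have "x (g + b - b) * y = 0"
  proof (rule gd_indep[OF R, rotated 3, where c = "\<lambda>h. x (h - b) * y"])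
    show "g + b \<in> (\<lambda>g. g + b) ` ?F" using g gx by simp
    show "finite ((\<lambda>g. g + b) ` ?F)" using F(1) by simp
    show "(\<lambda>g. g + b) ` ?F \<subseteq> degrees R" using y(2) by blast
    fix h assume "h \<in> (\<lambda>g. g + b) ` ?F"
    then obtain k where "k \<in> ?F" "h = k + b" by blast
    then show "x (h - b) * y \<in> component R h" using y(2)[of k] by simp
  qed
  then show False using y(1) gx by simp
qed

lemma hqf_sums_of: "sums_of (hqf_homogeneous R) \<subseteq> hqf R"
proof (rule sums_of_least)
  note S = gd_subring[OF R]
  have nz: "b * d \<in> nz_homogeneous R" if bd: "b \<in> nz_homogeneous R" "d \<in> nz_homogeneous R" for b d
  proof -
    obtain g h where "g \<in> degrees R" "h \<in> degrees R" "b \<in> component R g" "d \<in> component R h" "b \<noteq> 0" "d \<noteq> 0"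
      using bd unfolding nz_homogeneous_def by auto
    then show ?thesis
      unfolding nz_homogeneous_def using gd_mult[OF R, of g h b d] gd_degree_add[OF R, of g h] by (intro UN_I[of "g + h"]) auto
  qed
  have nzE: "b \<in> elements R" "b \<noteq> 0" if "b \<in> nz_homogeneous R" for b
    using that homog_elements[OF R] unfolding nz_homogeneous_def homog_def by auto
  obtain b y where yb: "b \<in> degrees R" "y \<in> component R b" "y \<noteq> 0" by (rule nonzero_homog)
  have "0 = 0 / y" by simp
  then show zero: "0 \<in> hqf R"
    using yb subring_setD(2)[OF S] unfolding hqf_def nz_homogeneous_def by blast
  show "hqf_homogeneous R \<subseteq> hqf R"
  proof
    fix z assume "z \<in> hqf_homogeneous R"
    then obtain g where g: "z \<in> hqf_component R g" unfolding hqf_homogeneous_def by auto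
    show "z \<in> hqf R"
    proof (cases "z = 0")
      case False
      obtain x y a b where "a \<in> degrees R" "b \<in> degrees R" "x \<in> component R a"
        "y \<in> component R b" "y \<noteq> 0" "z = x / y" by (rule hqf_componentE[OF g False]) (use False in blast)+
      then show ?thesis using homog_elements[OF R] unfolding hqf_def nz_homogeneous_def homog_def by blast
    qed (simp add: zero)
  qed
  fix z w assume "z \<in> hqf R" "w \<in> hqf R"
  then obtain x y x' y' where *: "z = x / y" "w = x' / y'" "x \<in> elements R" "x' \<in> elements R"
    "y \<in> nz_homogeneous R" "y' \<in> nz_homogeneous R" unfolding hqf_def by blast
  then have "z + w = (x * y' + x' * y) / (y * y')" using nzE by (simp add: field_simps)
  moreover have "x * y' + x' * y \<in> elements R" using * nzE by (auto intro!: subring_setD[OF S])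
  ultimately show "z + w \<in> hqf R" using nz[OF *(5,6)] unfolding hqf_def by blast
qed

lemma hqf_homogeneous_Int: "T \<inter> hqf_homogeneous R = (\<Union>g\<in>quotient_group (degrees R). T \<inter> hqf_component R g)"
  unfolding hqf_homogeneous_def by blast

text \<open>
  Since the components of the quotient field are independent, a subring is a homogeneous overring
  as soon as it is generated additively by its homogeneous elements.
\<close>

lemma homogeneous_overring_iff:
  "homogeneous_overring R T \<longleftrightarrow>
     subring_set T \<and> elements R \<subseteq> T \<and> T \<subseteq> sums_of (T \<inter> hqf_homogeneous R)"
proof
  assume "homogeneous_overring R T"
  then have "subring_set T" "elements R \<subseteq> T"
    "T = sums_of (\<Union>g\<in>quotient_group (degrees R). T \<inter> hqf_component R g)"
    unfolding homogeneous_overring_def internal_direct_sum_iff by argo+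
  then show "subring_set T \<and> elements R \<subseteq> T \<and> T \<subseteq> sums_of (T \<inter> hqf_homogeneous R)"
    unfolding hqf_homogeneous_Int by blast
next
  assume T: "subring_set T \<and> elements R \<subseteq> T \<and> T \<subseteq> sums_of (T \<inter> hqf_homogeneous R)"
  have "sums_of (T \<inter> hqf_homogeneous R) \<subseteq> T"
    by (rule sums_of_least) (use T subring_setD[of T] in auto)
  then have eq: "T = sums_of (T \<inter> hqf_homogeneous R)" using T by blast
  have "T \<subseteq> hqf R"
    using T hqf_sums_of sums_of_mono[of "T \<inter> hqf_homogeneous R" "hqf_homogeneous R"] by blast
  moreover have "internal_direct_sum (quotient_group (degrees R)) (\<lambda>g. T \<inter> hqf_component R g) T"
    unfolding internal_direct_sum_iff
  proof (intro conjI ballI allI impI)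
    show "T = sums_of (\<Union>g\<in>quotient_group (degrees R). T \<inter> hqf_component R g)"
      using eq unfolding hqf_homogeneous_Int .
    fix F x g assume "finite F \<and> F \<subseteq> quotient_group (degrees R) \<and> (\<forall>g\<in>F. x g \<in> T \<inter> hqf_component R g) \<and> sum x F = 0" "g \<in> F"
    then show "x g = 0" using hqf_component_indep[of F x g] by blast
  qed (use T subring_setD[of T] hqf_component_zero hqf_component_diff in auto)
  ultimately show "homogeneous_overring R T" using T unfolding homogeneous_overring_def by blast
qed

context
  fixes T assumes T: "homogeneous_overring R T"
begin

lemma overring_sums: "subring_set T" "elements R \<subseteq> T" "T \<subseteq> sums_of (T \<inter> hqf_homogeneous R)"
  using T homogeneous_overring_iff by auto

lemma overring_elements [simp]: "elements (overring_grading R T) = T"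
  unfolding overring_grading_def by simp

lemma overring_homog [simp]: "homog (overring_grading R T) = T \<inter> hqf_homogeneous R"
  unfolding overring_grading_def homog_def hqf_homogeneous_Int by simp

lemma graded_domain_overring: "graded_domain (overring_grading R T)"
  unfolding graded_domain_def
proof (intro conjI ballI)
  have deg: "degrees (overring_grading R T) = quotient_group (degrees R)"
    and comp: "component (overring_grading R T) = (\<lambda>g. T \<inter> hqf_component R g)"
    unfolding overring_grading_def by auto
  show "torsionless_monoid (degrees (overring_grading R T))"
    unfolding deg by (rule torsionless_quotient_group[OF torsionless_degrees])
  show "degrees (overring_grading R T) \<noteq> {0}"
    unfolding deg using quotient_group_incl[OF torsionless_degrees] monoid_zero[OF torsionless_degrees] gd_monoid(2)[OF R] by blast
  show "subring_set (elements (overring_grading R T))" using overring_sums by simp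
  show "internal_direct_sum (degrees (overring_grading R T)) (component (overring_grading R T)) (elements (overring_grading R T))"
    unfolding deg comp using T unfolding homogeneous_overring_def by simp
  fix a b x y assume "x \<in> component (overring_grading R T) a" "y \<in> component (overring_grading R T) b"
  then show "x * y \<in> component (overring_grading R T) (a + b)"
    unfolding comp using hqf_component_mult subring_setD(4)[OF overring_sums(1)] by auto
qed

lemma graded_subring_overring: "graded_subring R (overring_grading R T)"
  unfolding graded_subring_def
proof (intro conjI ballI subsetI)
  fix a x assume a: "a \<in> degrees R" "x \<in> component R a"
  then have "x \<in> T" using homog_elements[OF R] overring_sums(2) unfolding homog_def by blast
  then show "x \<in> component (overring_grading R T) a"
    using component_hqf_component[OF a] unfolding overring_grading_def by simp
qed (use R graded_domain_overring overring_sums quotient_group_incl[OF torsionless_degrees] in \<open>auto simp: overring_grading_def\<close>)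

end

lemma homogeneous_overring_self: "homogeneous_overring R (elements R)"
proof -
  have "homog R \<subseteq> elements R \<inter> hqf_homogeneous R"
    using homog_elements[OF R] homog_hqf_homogeneous by blast
  then show ?thesis
    unfolding homogeneous_overring_iff using gd_subring[OF R] gd_elements[OF R] sums_of_mono by blast
qed

lemma homogeneous_overring_adjoin:
  assumes A: "homogeneous_overring R A" and u: "u \<in> hqf_homogeneous R"
  shows "homogeneous_overring R (adjoin A u)"
  unfolding homogeneous_overring_iff
proof (intro conjI)
  note S = overring_sums[OF A]
  show "subring_set (adjoin A u)" by (rule subring_adjoin[OF S(1)])
  show "elements R \<subseteq> adjoin A u" using S(2) adjoin_incl[OF S(1)] by blast
  show "adjoin A u \<subseteq> sums_of (adjoin A u \<inter> hqf_homogeneous R)"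
  proof
    fix x assume "x \<in> adjoin A u"
    then obtain p where p: "x = poly p u" "\<And>i. coeff p i \<in> A" unfolding adjoin_def by blast
    have "u ^ i * coeff p i \<in> sums_of (adjoin A u \<inter> hqf_homogeneous R)" for i
    proof (rule sums_of_mult_left)
      show "coeff p i \<in> sums_of (A \<inter> hqf_homogeneous R)" using p(2) S(3) by blast
      fix c assume "c \<in> A \<inter> hqf_homogeneous R"
      then show "u ^ i * c \<in> sums_of (adjoin A u \<inter> hqf_homogeneous R)"
        using adjoin_monom[OF S(1), of c u i] hqf_homogeneous_mult[OF hqf_homogeneous_power[OF u], of c i]
        by (intro sums_of_incl) (auto simp: mult.commute)
    qed
    then show "x \<in> sums_of (adjoin A u \<inter> hqf_homogeneous R)"
      unfolding p(1) poly_altdef by (intro sums_of_sum) (simp add: mult.commute)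
  qed
qed

end

section \<open>Overrings in which a prime ideal survives\<close>

text \<open>
  For a homogeneous prime \<open>P\<close> of \<open>R\<close> and a homogeneous overring \<open>A\<close> this is equivalent to the existence
  of a homogeneous prime of \<open>A\<close> lying over \<open>P\<close>.  In this form the property passes to unions of chains.
\<close>

definition survives :: "('g, 'a::idom) graded_ring \<Rightarrow> 'a set \<Rightarrow> 'a set \<Rightarrow> bool" where
  "survives R P A \<longleftrightarrow> (\<forall>b\<in>homog R - P. b \<notin> mul_span P A)"

context
  fixes R :: "('g::ab_group_add, 'a::field) graded_ring"
  assumes R: "graded_domain R"
begin

lemma prime_over_surviving:
  assumes P: "homogeneous_prime R P" and A: "homogeneous_overring R A" and s: "survives R P A"
  obtains Q where "homogeneous_prime (overring_grading R A) Q" "Q \<inter> elements R = P"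
proof -
  let ?A = "overring_grading R A"
  note p = homogeneous_primeD[OF R P] and gA = graded_domain_overring[OF R A]
    and RA = graded_subring_overring[OF R A]
  have el: "elements ?A = A" using overring_elements[OF R A] .
  obtain Q where Q: "homogeneous_prime ?A Q" "mul_span P A \<subseteq> Q" "Q \<inter> (homog R - P) = {}"
  proof (rule exists_homogeneous_prime[OF gA homogeneous_ideal_extend(1)[OF RA p(1), unfolded el]])
    show "homog R - P \<subseteq> homog ?A" using graded_subringD(4)[OF RA] by blast
    show "homog R - P \<noteq> {}" using homog_outside_prime[OF R P] by blast
    show "mul_span P A \<inter> (homog R - P) = {}" using s unfolding survives_def by blast
    fix a b assume "a \<in> homog R - P" "b \<in> homog R - P"
    then show "a * b \<in> homog R - P"
      using homog_mult[OF R, of a b] prime_ideal_ofD(3)[OF p(2), of a b] homog_elements[OF R] by auto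
  qed blast
  note q = homogeneous_primeD[OF gA Q(1)]
  have "Q \<inter> homog R \<subseteq> P" using Q(3) by blast
  then have "Q \<inter> elements R \<subseteq> P" by (rule homogeneous_ideal_contract_subset[OF RA q(1) p(3)])
  moreover have "P \<subseteq> Q \<inter> elements R" using Q(2) homogeneous_ideal_extend(2)[OF RA p(1)] p(5) unfolding el by blast
  ultimately show ?thesis using that Q(1) by blast
qed

text \<open>
  The obstruction to going down: if \<open>P\<close> survives in an overring with going down, then so does every
  smaller prime \<open>P\<^sub>0\<close>, and hence the overring cannot contain \<open>r / p\<close> for \<open>p \<in> P\<^sub>0\<close> and \<open>r \<notin> P\<^sub>0\<close>.
\<close>

lemma gGD_no_fraction:
  assumes P: "homogeneous_prime R P" "homogeneous_prime R P\<^sub>0" "P\<^sub>0 \<subseteq> P"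
    and A: "homogeneous_overring R A" "survives R P A" "gGD R (overring_grading R A)"
    and u: "u \<in> A" "p \<in> P\<^sub>0" "p * u \<in> elements R"
  shows "p * u \<in> P\<^sub>0"
proof -
  obtain Q where Q: "homogeneous_prime (overring_grading R A) Q" "Q \<inter> elements R = P"
    using prime_over_surviving[OF P(1) A(1,2)] by blast
  obtain Q\<^sub>0 where Q0: "homogeneous_prime (overring_grading R A) Q\<^sub>0" "Q\<^sub>0 \<inter> elements R = P\<^sub>0"
    using A(3) P Q unfolding gGD_def by blast
  have "ideal_of A Q\<^sub>0"
    using homogeneous_primeD(3)[OF graded_domain_overring[OF R A(1)] Q0(1)] overring_elements[OF R A(1)] by simp
  then have "p * u \<in> Q\<^sub>0" using ideal_ofD(5)[of A Q\<^sub>0 u p] u Q0(2) by blast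
  then show ?thesis using Q0(2) u(3) by blast
qed

text \<open>
  With \<open>u = r / p\<close>, an element \<open>b\<close> of \<open>R\<close> outside \<open>P\<close> in the extension of \<open>P\<close> to \<open>R[u]\<close> is a polynomial in \<open>u\<close>
  with coefficients in \<open>P\<close>.  Multiplying by \<open>p ^ n\<close> and moving \<open>b\<close> into the coefficient of index
  zero gives an equation of integral dependence for \<open>p / r = 1 / u\<close>.
\<close>

lemma survives_adjoin_fraction:
  assumes P: "homogeneous_prime R P" and p: "p \<in> elements R" and r: "r \<in> elements R"
    and ni: "\<not> integral_over_prime (elements R) P r p"
  shows "p \<noteq> 0" "survives R P (adjoin (elements R) (r / p))"
proof -
  note S = gd_subring[OF R] and pr = homogeneous_primeD[OF R P]
  have one: "1 \<in> elements R - P" using prime_ideal_not_one[OF pr(2)] subring_setD(1)[OF S] by blast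
  show p0: "p \<noteq> 0"
  proof
    assume "p = 0"
    then have "integral_over_prime (elements R) P r p"
      unfolding integral_over_prime_def
      by (intro exI[of _ 1] exI[of _ "\<lambda>i. if i = 0 then 1 else 0"]) (use one ideal_ofD(2)[OF pr(3)] in auto)
    then show False using ni by simp
  qed
  show "survives R P (adjoin (elements R) (r / p))"
    unfolding survives_def
  proof (intro ballI notI)
    fix b assume b: "b \<in> homog R - P" "b \<in> mul_span P (adjoin (elements R) (r / p))"
    obtain f where f: "\<And>i. coeff f i \<in> mul_span P (elements R)" "b = poly f (r / p)"
      using mul_span_adjoinE[OF b(2)] by blast
    have "mul_span P (elements R) \<subseteq> P"
      unfolding mul_span_def by (rule ideal_of_sums_of[OF pr(3)]) (use ideal_ofD(5)[OF pr(3)] in auto)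
    then have fP: "coeff f i \<in> P" for i using f(1) by blast
    define n where "n = degree f"
    define a where "a i = (if i = 0 then coeff f 0 - b else coeff f i)" for i
    have bR: "b \<in> elements R" "b \<notin> P" using b(1) homog_elements[OF R] by auto
    have "a 0 \<in> elements R - P"
    proof -
      have "a 0 \<in> elements R" unfolding a_def using fP[of 0] pr(5) bR subring_setD(3)[OF S] by auto
      moreover have "a 0 \<notin> P"
      proof
        assume "a 0 \<in> P"
        then have "coeff f 0 - a 0 \<in> P" by (rule ideal_of_diff(1)[OF S pr(3) fP])
        then show False using bR unfolding a_def by simp
      qed
      ultimately show ?thesis by simp
    qed
    moreover have "\<forall>i\<in>{1..n}. a i \<in> P" unfolding a_def using fP by auto
    moreover have "(\<Sum>i\<le>n. a i * r ^ i * p ^ (n - i)) = 0"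
    proof -
      have "(\<Sum>i\<le>n. a i * r ^ i * p ^ (n - i)) = p ^ n * (\<Sum>i\<le>n. a i * (r / p) ^ i)"
        unfolding sum_distrib_left
        by (rule sum.cong) (use p0 in \<open>auto simp: power_divide power_diff field_simps\<close>)
      also have "(\<Sum>i\<le>n. a i * (r / p) ^ i) = (\<Sum>i\<le>n. coeff f i * (r / p) ^ i - (if i = 0 then b else 0))"
        by (rule sum.cong) (auto simp: a_def)
      also have "\<dots> = 0" unfolding sum_subtractf by (simp add: f(2) poly_altdef n_def)
      finally show ?thesis by simp
    qed
    ultimately show False using ni unfolding integral_over_prime_def by blast
  qed
qed

text \<open>
  The common part of the proofs from simple overrings and from gr-valuation overrings: either class
  has to supply, for each \<open>u\<close> such that \<open>P\<close> survives in \<open>R[u]\<close>, a member that contains \<open>u\<close> and in which \<open>P\<close>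
  survives.
\<close>

lemma going_down_integralI:
  assumes "\<And>P u. homogeneous_prime R P \<Longrightarrow> u \<in> hqf_homogeneous R \<Longrightarrow> survives R P (adjoin (elements R) u)
    \<Longrightarrow> \<exists>A. homogeneous_overring R A \<and> u \<in> A \<and> survives R P A \<and> gGD R (overring_grading R A)"
  shows "going_down_integral R"
  unfolding going_down_integral_def
proof (intro allI impI ballI, elim conjE, rule ccontr)
  fix P\<^sub>0 P p r
  assume P: "homogeneous_prime R P\<^sub>0" "homogeneous_prime R P" "P\<^sub>0 \<subseteq> P"
    and p: "p \<in> P\<^sub>0 \<inter> homog R" and r: "r \<in> homog R - P\<^sub>0"
    and ni: "\<not> integral_over_prime (elements R) P r p"
  have el: "p \<in> elements R" "r \<in> elements R" using p r homog_elements[OF R] by auto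
  note s = survives_adjoin_fraction[OF P(2) el ni]
  have "r / p \<in> hqf_homogeneous R"
    using hqf_homogeneous_divide[OF R] homog_hqf_homogeneous[OF R] p r by blast
  then obtain A where A: "homogeneous_overring R A" "r / p \<in> A" "survives R P A" "gGD R (overring_grading R A)"
    using assms P(2) s(2) by blast
  have "p * (r / p) \<in> P\<^sub>0"
    by (rule gGD_no_fraction[OF P(2,1,3) A(1,3,4,2)]) (use p el s(1) in auto)
  then show False using r s(1) by simp
qed

section \<open>Existence of gr-valuation overrings\<close>

lemma chain_common_member:
  assumes "\<C> \<noteq> {}" "\<And>X Y. X \<in> \<C> \<Longrightarrow> Y \<in> \<C> \<Longrightarrow> X \<subseteq> Y \<or> Y \<subseteq> X" "z \<in> mul_span P (\<Union>\<C>)"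
  shows "\<exists>X\<in>\<C>. z \<in> mul_span P X"
  using assms(3) unfolding mul_span_def[of P "\<Union>\<C>"]
proof induction
  case zero
  then show ?case using assms(1) mul_span_zero by blast
next
  case (add x y)
  obtain X where X: "X \<in> \<C>" "x \<in> mul_span P X" using add.hyps(1) mul_span_incl by blast
  obtain Y where Y: "Y \<in> \<C>" "y \<in> mul_span P Y" using add.IH by blast
  have "X \<union> Y \<in> \<C>" using assms(2)[OF X(1) Y(1)] X(1) Y(1) by (metis sup.absorb1 sup.absorb2)
  moreover have "x + y \<in> mul_span P (X \<union> Y)"
    using X Y mul_span_mono[of P P X "X \<union> Y"] mul_span_mono[of P P Y "X \<union> Y"] by (blast intro: mul_span_add)
  ultimately show ?case by blast
qed

lemma exists_maximal_surviving:
  assumes A: "homogeneous_overring R A" "survives R P A"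
  obtains V where "homogeneous_overring R V" "survives R P V" "A \<subseteq> V"
    "\<And>W. homogeneous_overring R W \<Longrightarrow> survives R P W \<Longrightarrow> V \<subseteq> W \<Longrightarrow> W = V"
proof -
  define \<A> where "\<A> = {V. homogeneous_overring R V \<and> survives R P V \<and> A \<subseteq> V}"
  have "\<exists>V\<in>\<A>. \<forall>X\<in>\<A>. V \<subseteq> X \<longrightarrow> X = V"
  proof (rule subset_Zorn_nonempty)
    show "\<A> \<noteq> {}" using A unfolding \<A>_def by auto
    fix \<C> assume \<C>: "\<C> \<noteq> {}" and "subset.chain \<A> \<C>"
    then have sub: "\<C> \<subseteq> \<A>" and ch: "\<And>X Y. X \<in> \<C> \<Longrightarrow> Y \<in> \<C> \<Longrightarrow> X \<subseteq> Y \<or> Y \<subseteq> X"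
      unfolding subset_chain_def by auto
    have ov: "subring_set X" "elements R \<subseteq> X" "X \<subseteq> sums_of (X \<inter> hqf_homogeneous R)" if "X \<in> \<C>" for X
      using that sub overring_sums[OF R, of X] unfolding \<A>_def by blast+
    have "subring_set (\<Union>\<C>)"
      unfolding subring_set_def
    proof (intro conjI ballI)
      show "1 \<in> \<Union>\<C>" using \<C> ov(1) subring_setD(1) by blast
      fix x y assume "x \<in> \<Union>\<C>" "y \<in> \<Union>\<C>"
      then obtain X where X: "X \<in> \<C>" "x \<in> X" "y \<in> X" using ch by blast
      then show "x - y \<in> \<Union>\<C>" "x * y \<in> \<Union>\<C>"
        using subring_setD(3,4)[OF ov(1)[OF X(1)] X(2,3)] by blast+
    qed
    moreover have "\<Union>\<C> \<subseteq> sums_of (\<Union>\<C> \<inter> hqf_homogeneous R)"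
    proof
      fix x assume "x \<in> \<Union>\<C>"
      then obtain X where X: "X \<in> \<C>" "x \<in> X" by blast
      have "X \<inter> hqf_homogeneous R \<subseteq> \<Union>\<C> \<inter> hqf_homogeneous R" using X by blast
      then show "x \<in> sums_of (\<Union>\<C> \<inter> hqf_homogeneous R)" using ov(3)[OF X(1)] X(2) sums_of_mono by blast
    qed
    ultimately have "homogeneous_overring R (\<Union>\<C>)"
      using \<C> ov(2) unfolding homogeneous_overring_iff[OF R] by blast
    moreover have "survives R P (\<Union>\<C>)"
      using chain_common_member[OF \<C> ch, of _ P] sub unfolding \<A>_def survives_def by blast
    moreover have "A \<subseteq> \<Union>\<C>" using \<C> sub unfolding \<A>_def by blast
    ultimately show "\<Union>\<C> \<in> \<A>" unfolding \<A>_def by blast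
  qed
  then obtain V where V: "V \<in> \<A>" and max: "\<And>X. X \<in> \<A> \<Longrightarrow> V \<subseteq> X \<Longrightarrow> X = V" by auto
  show ?thesis
  proof (rule that[of V])
    fix W assume "homogeneous_overring R W" "survives R P W" "V \<subseteq> W"
    then show "W = V" using V max[of W] unfolding \<A>_def by blast
  qed (use V in \<open>auto simp: \<A>_def\<close>)
qed

text \<open>
  If \<open>x\<close> and \<open>1 / x\<close> both had equations \<open>b = f(x)\<close> and \<open>c = g(1 / x)\<close> with \<open>f\<close> and \<open>g\<close> having
  coefficients in the prime \<open>Q\<close> and \<open>b\<close>, \<open>c\<close> outside \<open>Q\<close>, then up to a factor outside \<open>Q\<close> each power
  \<open>x ^ k\<close> with \<open>k \<le> deg f + deg g\<close> would be a combination of such powers with coefficients in \<open>Q\<close>: use \<open>f\<close> for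
  low and \<open>g\<close> for high powers.  This contradicts Nakayama's lemma.
\<close>

lemma not_both_adjunctions_blow_up:
  fixes x :: 'a
  assumes V: "subring_set V" and Q: "prime_ideal_of V Q" and x: "x \<noteq> 0"
    and f: "\<And>i. coeff f i \<in> Q" "poly f x \<in> V - Q" and g: "\<And>i. coeff g i \<in> Q" "poly g (1 / x) \<in> V - Q"
  shows False
proof -
  let ?n = "degree f" and ?m = "degree g"
  let ?X = "(\<lambda>k. x ^ k) ` {..?n + ?m}"
  have "?X \<subseteq> {0}"
  proof (rule nakayama[OF V Q])
    show "finite ?X" by simp
    fix z assume "z \<in> ?X"
    then obtain k where k: "z = x ^ k" "k \<le> ?n + ?m" by auto
    show "\<exists>d\<in>V - Q. d * z \<in> mul_span Q ?X"
    proof (cases "k \<le> ?m")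
      case True
      have "poly f x * z = (\<Sum>i\<le>?n. coeff f i * x ^ (i + k))"
        unfolding poly_altdef k sum_distrib_right by (simp add: power_add mult.assoc)
      also have "\<dots> \<in> mul_span Q ?X"
        by (intro mul_span_sum mul_span_incl f) (use True in auto)
      finally show ?thesis using f(2) by blast
    next
      case False
      have "poly g (1 / x) * z = (\<Sum>i\<le>?m. coeff g i * x ^ (k - i))"
        unfolding poly_altdef k sum_distrib_right
        by (rule sum.cong) (use False x in \<open>auto simp: power_diff power_divide\<close>)
      also have "\<dots> \<in> mul_span Q ?X"
        by (intro mul_span_sum mul_span_incl g) (use k False in auto)
      finally show ?thesis using g(2) by blast
    qed
  qed
  moreover have "1 \<in> ?X" by (rule image_eqI[of _ _ 0]) auto
  ultimately show False by auto
qed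

text \<open>
  Take \<open>V\<close> maximal among the homogeneous overrings in which \<open>P\<close> survives.  If neither of \<open>x\<close> and \<open>1 / x\<close> belongs
  to \<open>V\<close>, then by maximality \<open>P\<close> survives in neither \<open>V[x]\<close> nor \<open>V[1 / x]\<close>, which gives the two equations
  excluded above.
\<close>

lemma exists_surviving_gr_valuation_overring:
  assumes P: "homogeneous_prime R P" and A: "homogeneous_overring R A" "survives R P A"
  obtains V where "gr_valuation_overring R V" "survives R P V" "A \<subseteq> V"
proof -
  obtain V where V: "homogeneous_overring R V" "survives R P V" "A \<subseteq> V"
    and max: "\<And>W. homogeneous_overring R W \<Longrightarrow> survives R P W \<Longrightarrow> V \<subseteq> W \<Longrightarrow> W = V"
    using exists_maximal_surviving[OF A] by blast
  note S = overring_sums[OF R V(1)] and gV = graded_domain_overring[OF R V(1)]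
  have el: "elements (overring_grading R V) = V" using overring_elements[OF R V(1)] .
  obtain Q where Q: "homogeneous_prime (overring_grading R V) Q" "Q \<inter> elements R = P"
    using prime_over_surviving[OF P V(1,2)] by blast
  note q = homogeneous_primeD[OF gV Q(1), unfolded el]
  have PQ: "mul_span P V \<subseteq> Q"
    unfolding mul_span_def by (rule ideal_of_sums_of[OF q(3)]) (use ideal_ofD(5)[OF q(3)] Q(2) in blast)
  have blow_up: "\<exists>f. (\<forall>i. coeff f i \<in> Q) \<and> poly f x \<in> V - Q"
    if x: "x \<in> hqf_homogeneous R" "x \<notin> V" for x
  proof -
    have "adjoin V x \<noteq> V" using adjoin_generator[OF S(1)] x(2) by blast
    then have "\<not> survives R P (adjoin V x)"
      using max[OF homogeneous_overring_adjoin[OF R V(1) x(1)] _ adjoin_incl[OF S(1)]] by blast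
    then obtain b where b: "b \<in> homog R - P" "b \<in> mul_span P (adjoin V x)" unfolding survives_def by blast
    obtain f where f: "\<And>i. coeff f i \<in> mul_span P V" "b = poly f x"
      using mul_span_adjoinE[OF b(2)] by blast
    have "b \<in> V - Q" using b(1) Q(2) homog_elements[OF R] S(2) by blast
    then show ?thesis using f PQ by blast
  qed
  have val: "x \<in> V \<or> 1 / x \<in> V" if x: "x \<in> hqf_homogeneous R" "x \<noteq> 0" for x
  proof (rule ccontr)
    assume "\<not> ?thesis"
    then show False
      using blow_up[OF x(1)] blow_up[OF hqf_homogeneous_inverse[OF R x(1)]]
        not_both_adjunctions_blow_up[OF S(1) q(2) x(2)] by blast
  qed
  have "gr_valuation_domain (overring_grading R V)"
    unfolding gr_valuation_domain_def el
  proof (intro conjI ballI)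
    fix a b assume "a \<in> nz_homogeneous (overring_grading R V)" "b \<in> nz_homogeneous (overring_grading R V)"
    then have ab: "a \<in> hqf_homogeneous R" "a \<noteq> 0" "b \<in> hqf_homogeneous R" "b \<noteq> 0"
      unfolding nz_homogeneous_def hqf_homogeneous_def overring_grading_def by auto
    have incl: "(*) c ` V \<subseteq> (*) d ` V" if "c / d \<in> V" "d \<noteq> 0" for c d
    proof clarify
      fix v assume "v \<in> V"
      then have "c / d * v \<in> V" by (intro subring_setD(4)[OF S(1)] that(1))
      moreover have "c * v = d * (c / d * v)" using that(2) by simp
      ultimately show "c * v \<in> (*) d ` V" by blast
    qed
    show "(*) a ` V \<subseteq> (*) b ` V \<or> (*) b ` V \<subseteq> (*) a ` V"
      using val[OF hqf_homogeneous_divide[OF R ab(1,3)]] incl[of a b] incl[of b a] ab by auto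
  qed (rule gV)
  then show ?thesis using that V unfolding gr_valuation_overring_def by blast
qed

end

section \<open>Invariance under isomorphism\<close>

text \<open>
  The equations of integral dependence involve elements of \<open>R\<close> only, so they carry over to
  isomorphic graded rings.
\<close>

lemma going_down_integral_isomorphic:
  fixes R :: "('g::ab_group_add, 'a::idom) graded_ring" and S :: "('h::ab_group_add, 'b::idom) graded_ring"
  assumes R: "graded_domain R" and S: "graded_domain S" and iso: "graded_isomorphic R S"
    and gdi: "going_down_integral R"
  shows "going_down_integral S"
proof -
  obtain \<phi> \<psi> where bij: "bij_betw \<phi> (elements R) (elements S)" and one: "\<phi> 1 = 1"
    and hom': "\<forall>x\<in>elements R. \<forall>y\<in>elements R. \<phi> (x + y) = \<phi> x + \<phi> y \<and> \<phi> (x * y) = \<phi> x * \<phi> y"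
    and deg: "bij_betw \<psi> (degrees R) (degrees S)"
    and comp': "\<forall>a\<in>degrees R. \<phi> ` component R a = component S (\<psi> a)"
    using iso unfolding graded_isomorphic_def by (elim exE conjE)
  have hom: "\<And>x y. x \<in> elements R \<Longrightarrow> y \<in> elements R \<Longrightarrow> \<phi> (x + y) = \<phi> x + \<phi> y"
      "\<And>x y. x \<in> elements R \<Longrightarrow> y \<in> elements R \<Longrightarrow> \<phi> (x * y) = \<phi> x * \<phi> y"
    and comp: "\<And>a. a \<in> degrees R \<Longrightarrow> \<phi> ` component R a = component S (\<psi> a)"
    using hom' comp' by auto
  note rR = gd_subring[OF R] and hR = homog_elements[OF R]
  have im: "\<phi> ` elements R = elements S" and inj: "inj_on \<phi> (elements R)"
    using bij unfolding bij_betw_def by auto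
  have zero: "\<phi> 0 = 0"
    using hom(1)[OF subring_setD(2)[OF rR] subring_setD(2)[OF rR]] by (simp only: add_0_right add_cancel_right_right)
  have imH: "\<phi> ` homog R = homog S"
  proof -
    have "\<phi> ` homog R = (\<Union>a\<in>degrees R. component S (\<psi> a))"
      unfolding homog_def image_UN using comp by auto
    also have "\<dots> = homog S" unfolding homog_def bij_betw_imp_surj_on[OF deg, symmetric] by simp
    finally show ?thesis .
  qed
  have pow: "\<phi> (x ^ n) = \<phi> x ^ n" if "x \<in> elements R" for x n
    by (induction n) (use that one hom(2) subring_setD(7)[OF rR] in auto)
  have sum: "\<phi> (\<Sum>i\<in>F. h i) = (\<Sum>i\<in>F. \<phi> (h i))" if "finite F" "\<And>i. i \<in> F \<Longrightarrow> h i \<in> elements R"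
    for F and h :: "nat \<Rightarrow> 'a"
    using that by (induction F) (auto simp: zero hom(1) subring_set_sum[OF rR])
  define pull where "pull P = {x \<in> elements R. \<phi> x \<in> P}" for P
  have pull: "homogeneous_prime R (pull P)" if P: "homogeneous_prime S P" for P
  proof -
    note p = homogeneous_primeD[OF S P]
    have idl: "ideal_of (elements R) (pull P)"
      unfolding ideal_of_def
    proof (intro conjI ballI)
      show "pull P \<subseteq> elements R" "0 \<in> pull P"
        unfolding pull_def using zero subring_setD(2)[OF rR] ideal_ofD(2)[OF p(3)] by auto
      fix x assume x: "x \<in> pull P"
      show "x + y \<in> pull P" if "y \<in> pull P" for y
        using x that subring_setD(6)[OF rR, of x y] ideal_ofD(3)[OF p(3), of "\<phi> x" "\<phi> y"]
        unfolding pull_def by (simp add: hom)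
      show "s * x \<in> pull P" if "s \<in> elements R" for s
        using x that im subring_setD(4)[OF rR, of s x] ideal_ofD(4)[OF p(3), of "\<phi> s" "\<phi> x"]
        unfolding pull_def by (auto simp: hom)
    qed
    have "z \<in> \<phi> ` sums_of (pull P \<inter> homog R)" if "z \<in> sums_of (P \<inter> homog S)" for z
      using that
    proof induction
      case zero
      then show ?case by (rule image_eqI[where x=0]) (auto simp: \<open>\<phi> 0 = 0\<close>)
    next
      case (add x y)
      obtain x' where x: "x = \<phi> x'" "x' \<in> homog R" using add.hyps(1) imH by blast
      obtain y' where y: "y = \<phi> y'" "y' \<in> sums_of (pull P \<inter> homog R)" using add.IH by blast
      have x': "x' \<in> pull P \<inter> homog R" using x add.hyps(1) hR unfolding pull_def by blast
      have "sums_of (pull P \<inter> homog R) \<subseteq> elements R"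
        by (rule order_trans[OF ideal_of_sums_of[OF idl] ideal_ofD(1)[OF idl]]) blast
      then have "\<phi> (x' + y') = x + y" using hom(1)[of x' y'] x y hR by auto
      then show ?case using sums_of.add[OF x' y(2)] by (metis image_eqI)
    qed
    then have pre: "\<phi> ` pull P \<subseteq> \<phi> ` sums_of (pull P \<inter> homog R)" using p(4) unfolding pull_def by blast
    have "pull P \<subseteq> sums_of (pull P \<inter> homog R)"
    proof
      fix x assume x: "x \<in> pull P"
      then obtain y where y: "\<phi> x = \<phi> y" "y \<in> sums_of (pull P \<inter> homog R)" using pre by blast
      moreover have "sums_of (pull P \<inter> homog R) \<subseteq> pull P" by (rule ideal_of_sums_of[OF idl]) blast
      ultimately have "x = y" using x inj ideal_ofD(1)[OF idl] by (blast dest: inj_onD)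
      then show "x \<in> sums_of (pull P \<inter> homog R)" using y by simp
    qed
    moreover have "pull P \<noteq> elements R"
    proof -
      have "1 \<notin> pull P" unfolding pull_def using prime_ideal_not_one[OF p(2)] one by simp
      then show ?thesis using subring_setD(1)[OF rR] by blast
    qed
    moreover have "\<forall>x\<in>elements R. \<forall>y\<in>elements R. x * y \<in> pull P \<longrightarrow> x \<in> pull P \<or> y \<in> pull P"
    proof (intro ballI impI)
      fix x y assume xy: "x \<in> elements R" "y \<in> elements R" "x * y \<in> pull P"
      moreover have "\<phi> x \<in> elements S" "\<phi> y \<in> elements S" using xy im by auto
      ultimately show "x \<in> pull P \<or> y \<in> pull P"
        using prime_ideal_ofD(3)[OF p(2), of "\<phi> x" "\<phi> y"] unfolding pull_def by (simp add: hom)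
    qed
    ultimately show ?thesis
      using idl unfolding homogeneous_prime_def prime_ideal_of_def homogeneous_ideal_iff[OF R] by blast
  qed
  show ?thesis
    unfolding going_down_integral_def
  proof (intro allI impI ballI, elim conjE)
    fix P\<^sub>0 P p r
    assume P: "homogeneous_prime S P\<^sub>0" "homogeneous_prime S P" "P\<^sub>0 \<subseteq> P"
      and pr: "p \<in> P\<^sub>0 \<inter> homog S" "r \<in> homog S - P\<^sub>0"
    obtain p' r' where pr': "p = \<phi> p'" "p' \<in> homog R" "r = \<phi> r'" "r' \<in> homog R" using pr imH by blast
    have el: "p' \<in> elements R" "r' \<in> elements R" using pr' hR by auto
    have "integral_over_prime (elements R) (pull P) r' p'"
      using gdi pull[OF P(1)] pull[OF P(2)] P(3) pr pr' el
      unfolding going_down_integral_def pull_def by blast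
    then obtain n a where a: "a 0 \<in> elements R - pull P" "\<And>i. i \<in> {1..n} \<Longrightarrow> a i \<in> pull P"
      "(\<Sum>i\<le>n. a i * r' ^ i * p' ^ (n - i)) = 0" unfolding integral_over_prime_def by blast
    have aR: "a i \<in> elements R" if "i \<le> n" for i
      using a(1) a(2)[of i] that unfolding pull_def by (cases "i = 0") auto
    have "(\<Sum>i\<le>n. \<phi> (a i) * r ^ i * p ^ (n - i)) = \<phi> (\<Sum>i\<le>n. a i * r' ^ i * p' ^ (n - i))"
      using aR el by (subst sum) (auto simp: hom(2) pow pr' subring_setD[OF rR])
    also have "\<dots> = 0" using a(3) zero by simp
    finally have "(\<Sum>i\<le>n. \<phi> (a i) * r ^ i * p ^ (n - i)) = 0" .
    moreover have "\<phi> (a 0) \<in> elements S - P" "\<forall>i\<in>{1..n}. \<phi> (a i) \<in> P"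
      using a(1,2) im unfolding pull_def by blast+
    ultimately show "integral_over_prime (elements S) P r p"
      unfolding integral_over_prime_def by (intro exI[of _ n] exI[of _ "\<lambda>i. \<phi> (a i)"]) blast
  qed
qed

section \<open>The equivalence\<close>

theorem theorem3p12:
  fixes R :: "('g::ab_group_add, 'a::field) graded_ring"
  assumes "graded_domain R"
  shows "(gGD_domain R \<longleftrightarrow>
            (\<forall>u\<in>hqf_homogeneous R. gGD R (overring_grading R (adjoin (elements R) u)))) \<and>
         (gGD_domain R \<longleftrightarrow>
            (\<forall>V. gr_valuation_overring R V \<longrightarrow> gGD R (overring_grading R V))) \<and>
         (gGD_domain R \<longleftrightarrow>
            (\<forall>T::('g, 'a) graded_ring. graded_subring R T \<longrightarrow> gGD R T)) \<and>
         (gGD_domain R \<longrightarrow>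
            (\<forall>(S::('h::ab_group_add, 'b::idom) graded_ring) T.
               graded_isomorphic R S \<and> graded_subring S T \<longrightarrow> gGD S T))"
proof -
  note R = assms
  let ?simple = "\<forall>u\<in>hqf_homogeneous R. gGD R (overring_grading R (adjoin (elements R) u))"
  let ?val = "\<forall>V. gr_valuation_overring R V \<longrightarrow> gGD R (overring_grading R V)"
  let ?all = "\<forall>T::('g, 'a) graded_ring. graded_subring R T \<longrightarrow> gGD R T"
  note simple = homogeneous_overring_adjoin[OF R homogeneous_overring_self[OF R]]
  have 12: "gGD_domain R \<Longrightarrow> ?simple" and 13: "gGD_domain R \<Longrightarrow> ?val"
    using simple unfolding gGD_domain_def gr_valuation_overring_def by blast+
  have 2: "going_down_integral R" if ?simple
  proof (rule going_down_integralI[OF R])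
    fix P u assume "u \<in> hqf_homogeneous R" "survives R P (adjoin (elements R) u)"
    then show "\<exists>A. homogeneous_overring R A \<and> u \<in> A \<and> survives R P A \<and> gGD R (overring_grading R A)"
      using that simple adjoin_generator[OF gd_subring[OF R]] by blast
  qed
  have 3: "going_down_integral R" if ?val
  proof (rule going_down_integralI[OF R])
    fix P u assume u: "homogeneous_prime R P" "u \<in> hqf_homogeneous R" "survives R P (adjoin (elements R) u)"
    obtain V where "gr_valuation_overring R V" "survives R P V" "adjoin (elements R) u \<subseteq> V"
      using exists_surviving_gr_valuation_overring[OF R u(1) simple[OF u(2)] u(3)] by blast
    then show "\<exists>A. homogeneous_overring R A \<and> u \<in> A \<and> survives R P A \<and> gGD R (overring_grading R A)"
      using that adjoin_generator[OF gd_subring[OF R]] unfolding gr_valuation_overring_def by blast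
  qed
  have 4: "?all" if "going_down_integral R"
    using going_down_integral_imp_gGD[OF that] by blast
  have 41: "gGD_domain R" if ?all
    using that graded_subring_overring[OF R] unfolding gGD_domain_def by blast
  have iso: "gGD S T" if "gGD_domain R" "graded_isomorphic R S" "graded_subring S T"
    for S T :: "('h::ab_group_add, 'b::idom) graded_ring"
    using going_down_integral_imp_gGD[OF going_down_integral_isomorphic[OF R graded_subringD(1)] that(3)]
      that 2[OF 12] by blast
  show ?thesis using 12 13 2 3 4 41 iso by blast
qed

end
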